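(* For all $n > 0$, $n - 1 \leq \mathcal{G}(K_n, P_5) \leq n + 2$.
   Context: $P_5$ denotes the path on 5 vertices. For a family $\mathcal{F}$ of graphs, a graph is $\mathcal{F}$-free if it contains no member of $\mathcal{F}$ as a subgraph; a subgraph $G \subseteq H$ is $\mathcal{F}$-saturated in $H$ if it is a maximal $\mathcal{F}$-free subgraph of $H$. The $\mathcal{F}$-saturation game $\mathcal{G}(H;\mathcal{F})$: two players, Prolonger and Shortener, alternately add to a graph on $V(H)$, starting from the empty graph, one edge of $H$ not yet present such that the graph remains $\mathcal{F}$-free; the game ends when the graph is $\mathcal{F}$-saturated in $H$. Prolonger aims to maximise and Shortener to minimise the number of edges added; $\mathcal{G}(H;\mathcal{F})$ also denotes this number under optimal play by both players (the game saturation number). The bounds hold regardless of which player moves first. $\mathcal{G}(K_n, P_5)$ means $H = K_n$, $\mathcal{F} = \{P_5\}$. *)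

theory Defs
  imports Main
begin

text \<open>Graphs are finite or infinite simple graphs, given as a pair of a vertex set and a set of
  two-element edges.\<close>

type_synonym 'a ugraph = "'a set \<times> 'a set set"

abbreviation verts :: "'a ugraph \<Rightarrow> 'a set" where "verts \<equiv> fst"
abbreviation edges :: "'a ugraph \<Rightarrow> 'a set set" where "edges \<equiv> snd"

definition simple_graph :: "'a ugraph \<Rightarrow> bool" where
  "simple_graph G \<longleftrightarrow> (\<forall>e\<in>edges G. e \<subseteq> verts G \<and> card e = 2)"

definition subgraph :: "'a ugraph \<Rightarrow> 'a ugraph \<Rightarrow> bool" where
  "subgraph G H \<longleftrightarrow> simple_graph G \<and> simple_graph H \<and> verts G \<subseteq> verts H \<and> edges G \<subseteq> edges H"

definition complete_graph :: "nat \<Rightarrow> nat ugraph" where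
  "complete_graph n = ({..<n}, {e. e \<subseteq> {..<n} \<and> card e = 2})"

definition path_graph :: "nat \<Rightarrow> nat ugraph" where
  "path_graph k = ({..<k}, {{i, Suc i} | i. Suc i < k})"

text \<open>\<open>G\<close> contains a (not necessarily induced) copy of \<open>F\<close>.\<close>

definition contains_graph :: "'a ugraph \<Rightarrow> 'b ugraph \<Rightarrow> bool" where
  "contains_graph G F \<longleftrightarrow>
     (\<exists>f. inj_on f (verts F) \<and> f ` verts F \<subseteq> verts G \<and> (\<forall>e\<in>edges F. f ` e \<in> edges G))"

definition free :: "'b ugraph set \<Rightarrow> 'a ugraph \<Rightarrow> bool" where
  "free \<F> G \<longleftrightarrow> (\<forall>F\<in>\<F>. \<not> contains_graph G F)"

definition saturated :: "'b ugraph set \<Rightarrow> 'a ugraph \<Rightarrow> 'a ugraph \<Rightarrow> bool" where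
  "saturated \<F> H G \<longleftrightarrow> subgraph G H \<and> free \<F> G \<and>
     (\<forall>G'. subgraph G' H \<and> free \<F> G' \<and> subgraph G G' \<longrightarrow> G' = G)"

datatype player = Prolonger | Shortener

fun opponent :: "player \<Rightarrow> player" where
  "opponent Prolonger = Shortener"
| "opponent Shortener = Prolonger"

text \<open>A position of the game is the edge set of the current graph, whose vertex set is always
  that of \<open>H\<close>.\<close>

definition legal_moves :: "'b ugraph set \<Rightarrow> 'a ugraph \<Rightarrow> 'a set set \<Rightarrow> 'a set set" where
  "legal_moves \<F> H E = {e \<in> edges H - E. free \<F> (verts H, insert e E)}"

text \<open>\<open>game_value \<F> H p E\<close> is the number of edges of the final graph under optimal play from
  the position \<open>E\<close> with \<open>p\<close> to move. The finiteness test is only there to make the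
  recursion terminate.\<close>

function game_value ::
  "'b ugraph set \<Rightarrow> 'a ugraph \<Rightarrow> player \<Rightarrow> 'a set set \<Rightarrow> nat" where
  "game_value \<F> H p E =
    (if infinite (edges H) \<or> saturated \<F> H (verts H, E) then card E
     else case p of
       Prolonger \<Rightarrow>
         Max ((\<lambda>e. game_value \<F> H (opponent p) (insert e E)) ` legal_moves \<F> H E)
     | Shortener \<Rightarrow>
         Min ((\<lambda>e. game_value \<F> H (opponent p) (insert e E)) ` legal_moves \<F> H E))"
  by pat_completeness auto
termination
proof (relation "measure (\<lambda>(\<F>, H, p, E). card (edges H - E))", goal_cases)
  case 1
  then show ?case by simp
next
  case (2 \<F> H p E e)
  then have "edges H - insert e E \<subset> edges H - E" and "finite (edges H - E)"
    by (auto simp: legal_moves_def)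
  then show ?case by (simp add: psubset_card_mono)
next
  case (3 \<F> H p E e)
  then have "edges H - insert e E \<subset> edges H - E" and "finite (edges H - E)"
    by (auto simp: legal_moves_def)
  then show ?case by (simp add: psubset_card_mono)
qed

declare game_value.simps [simp del]

text \<open>\<open>game_sat p H \<F>\<close> is the game saturation number of \<open>H\<close> with respect to the
  family \<open>\<F>\<close> when \<open>p\<close> moves first; as play starts from the empty graph, the number of
  edges added is that of the final graph.\<close>

definition game_sat :: "player \<Rightarrow> 'a ugraph \<Rightarrow> 'b ugraph set \<Rightarrow> nat" where
  "game_sat p H \<F> = game_value \<F> H p {}"

text \<open>The game ends exactly when the player to move has no legal move, so the maxima and minima
  in \<^const>\<open>game_value\<close> range over nonempty sets.\<close>

lemma free_mono:
  assumes "free \<F> (V, E)" and "D \<subseteq> E"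
  shows "free \<F> (V, D)"
  using assms unfolding free_def contains_graph_def by (metis fst_conv snd_conv subsetD)

lemma saturated_iff_legal_moves_empty:
  assumes H: "simple_graph H" and E: "E \<subseteq> edges H" and free: "free \<F> (verts H, E)"
  shows "saturated \<F> H (verts H, E) \<longleftrightarrow> legal_moves \<F> H E = {}"
proof
  assume sat: "saturated \<F> H (verts H, E)"
  have False if "e \<in> legal_moves \<F> H E" for e
  proof -
    from that have "e \<in> edges H" "e \<notin> E" "free \<F> (verts H, insert e E)"
      by (auto simp: legal_moves_def)
    moreover have "subgraph (verts H, insert e E) H" "subgraph (verts H, E) (verts H, insert e E)"
      using H E \<open>e \<in> edges H\<close> by (auto simp: subgraph_def simple_graph_def)
    ultimately have "(verts H, insert e E) = (verts H, E)"
      using sat unfolding saturated_def by blast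
    with \<open>e \<notin> E\<close> show False by auto
  qed
  then show "legal_moves \<F> H E = {}" by blast
next
  assume none: "legal_moves \<F> H E = {}"
  have "G' = (verts H, E)"
    if "subgraph G' H" "free \<F> G'" "subgraph (verts H, E) G'" for G'
  proof -
    obtain V' E' where G': "G' = (V', E')" by (cases G')
    from that have V': "V' = verts H" and "E \<subseteq> E'" "E' \<subseteq> edges H"
      by (auto simp: subgraph_def G')
    moreover have "e \<in> E" if "e \<in> E'" for e
    proof (rule ccontr)
      assume "e \<notin> E"
      moreover have "free \<F> (verts H, insert e E)"
        using \<open>free \<F> G'\<close> \<open>E \<subseteq> E'\<close> \<open>e \<in> E'\<close> unfolding G' V' by (auto intro: free_mono)
      ultimately show False
        using none \<open>E' \<subseteq> edges H\<close> \<open>e \<in> E'\<close> by (auto simp: legal_moves_def)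
    qed
    ultimately show ?thesis by (auto simp: G')
  qed
  moreover have "subgraph (verts H, E) H"
    using H E by (auto simp: subgraph_def simple_graph_def)
  ultimately show "saturated \<F> H (verts H, E)"
    using free by (auto simp: saturated_def)
qed

end

theory Submission imports Defs
begin

text \<open>A connected \<open>P\<^sub>5\<close>-free graph on \<open>v \<noteq> 4\<close> vertices has at most \<open>v\<close> edges, and on four vertices
  at most six. So the final graph has at most \<open>n + 2 q\<close> edges, where \<open>q\<close> is the number of its
  four-vertex components, and at least \<open>n - t\<close>, where \<open>t\<close> is the number of its tree components.

  Shortener achieves \<open>q \<le> 1\<close> by leaving no four-vertex component and at most one
  two-vertex component: when Prolonger attaches an isolated vertex to a three-vertex component,
  Shortener attaches another one to the same neighbour, and otherwise Shortener builds a component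
  on two or three vertices. This can only fail once so few isolated vertices are left that at most
  one four-vertex component can still arise.

  Prolonger achieves \<open>t \<le> 1\<close> by closing a cycle in every tree with at least three vertices that
  Shortener creates; when there is nothing to close, Prolonger joins the two smallest trees.\<close>

subsection \<open>\<open>P\<^sub>5\<close>-free edge sets\<close>

definition pairs :: "'a set \<Rightarrow> 'a set set" where
  "pairs V = {e. e \<subseteq> V \<and> card e = 2}"

lemma pairs_iff [simp]: "{a, b} \<in> pairs V \<longleftrightarrow> a \<in> V \<and> b \<in> V \<and> a \<noteq> b"
  by (auto simp: pairs_def card_2_iff doubleton_eq_iff)

lemma pairsE:
  assumes "e \<in> pairs V"
  obtains a b where "e = {a, b}" "a \<in> V" "b \<in> V" "a \<noteq> b"
  using assms by (auto simp: pairs_def card_2_iff)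

lemma finite_pairs: "finite V \<Longrightarrow> finite (pairs V)"
  by (simp add: pairs_def)

lemma edges_complete_graph: "edges (complete_graph n) = pairs {..<n}"
  and verts_complete_graph: "verts (complete_graph n) = {..<n}"
  by (simp_all add: complete_graph_def pairs_def)

definition p5_free :: "'a set set \<Rightarrow> bool" where
  "p5_free E \<longleftrightarrow> (\<forall>a b c d e. distinct [a, b, c, d, e] \<longrightarrow>
     \<not> ({a, b} \<in> E \<and> {b, c} \<in> E \<and> {c, d} \<in> E \<and> {d, e} \<in> E))"

lemma p5_freeD:
  assumes "p5_free E" "distinct [a, b, c, d, e]"
    "{a, b} \<in> E" "{b, c} \<in> E" "{c, d} \<in> E" "{d, e} \<in> E"
  shows False
  using assms unfolding p5_free_def by blast

lemma edges_path_graph_5: "edges (path_graph 5) = {{0, 1}, {1, 2}, {2, 3}, {3, 4}}"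
proof -
  have "{{i, Suc i} | i. Suc i < 5} = (\<lambda>i. {i, Suc i}) ` {..<4}"
    by auto
  also have "\<dots> = {{0, 1}, {1, 2}, {2, 3}, {3, 4}}"
    by (simp add: lessThan_nat_numeral lessThan_Suc insert_commute numeral_eq_Suc)
  finally show ?thesis by (simp add: path_graph_def)
qed

lemma verts_path_graph_5: "verts (path_graph 5) = {0, 1, 2, 3, 4}"
  by (auto simp: path_graph_def)

text \<open>Every vertex of \<open>P\<^sub>5\<close> lies on an edge, so
  \<open>E \<subseteq> pairs V\<close> already places each copy inside \<open>V\<close>. This lets
  \<open>p5_free\<close> do without the vertex set.\<close>

lemma free_path_graph_5_iff:
  assumes "E \<subseteq> pairs V"
  shows "free {path_graph 5} (V, E) \<longleftrightarrow> p5_free E"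
proof
  assume free: "free {path_graph 5} (V, E)"
  show "p5_free E"
    unfolding p5_free_def
  proof (intro allI impI notI)
    fix a b c d e
    assume dist: "distinct [a, b, c, d, e]"
      and path: "{a, b} \<in> E \<and> {b, c} \<in> E \<and> {c, d} \<in> E \<and> {d, e} \<in> E"
    define f where "f i = [a, b, c, d, e] ! i" for i
    have f: "f 0 = a" "f 1 = b" "f 2 = c" "f 3 = d" "f 4 = e"
      by (simp_all add: f_def)
    have V: "a \<in> V" "b \<in> V" "c \<in> V" "d \<in> V" "e \<in> V"
      using path assms pairs_iff by (metis subsetD)+
    have "contains_graph (V, E) (path_graph 5)"
      unfolding contains_graph_def verts_path_graph_5 edges_path_graph_5
      using dist path V f by (intro exI[of _ f]) (auto simp: inj_on_def)
    with free show False by (simp add: free_def)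
  qed
next
  assume free: "p5_free E"
  have False if "inj_on f {0, 1, 2, 3, 4}"
    and "\<forall>e\<in>{{0, 1}, {1, 2}, {2, 3}, {3, 4 :: nat}}. f ` e \<in> E" for f
    by (rule p5_freeD[OF free, of "f 0" "f 1" "f 2" "f 3" "f 4"])
      (use that in \<open>auto simp: inj_on_def\<close>)
  then show "free {path_graph 5} (V, E)"
    unfolding free_def contains_graph_def verts_path_graph_5[symmetric] edges_path_graph_5[symmetric]
    by (simp only: fst_conv snd_conv) blast
qed

text \<open>After the insertion, \<open>y\<close> and \<open>y'\<close> are twins hanging at \<open>x\<close>: a path avoiding one of the
  edges \<open>{x, y}\<close>, \<open>{x, y'}\<close> can be moved back into \<open>E\<close> by exchanging them, and a path using both
  is stuck after three vertices.\<close>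

lemma p5_free_insert_twin:
  assumes free: "p5_free E" and xy: "{x, y} \<in> E" and "x \<noteq> y" "y \<noteq> y'"
    and y: "\<And>z. {y, z} \<in> E \<Longrightarrow> z \<in> {x, y'}"
    and y': "\<And>z. {y', z} \<in> E \<Longrightarrow> z \<in> {x, y}"
  shows "p5_free (insert {x, y'} E)"
  unfolding p5_free_def
proof (intro allI impI notI)
  fix a b c d e
  let ?E = "insert {x, y'} E"
  assume dist: "distinct [a, b, c, d, e]"
    and path: "{a, b} \<in> ?E \<and> {b, c} \<in> ?E \<and> {c, d} \<in> ?E \<and> {d, e} \<in> ?E"
  define s where "s z = (if z = y then y' else if z = y' then y else z)" for z
  have inj: "s p = s q \<longleftrightarrow> p = q" for p q
    by (auto simp: s_def)
  \<comment> \<open>The exchange \<open>s\<close> fixes \<open>{y, y'}\<close> and moves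
    \<open>{x, y'}\<close> to \<open>{x, y}\<close>, so it maps the enlarged graph back into
    \<open>E\<close>, except that the image of \<open>{x, y}\<close> itself may be missing
    there.\<close>
  have swap: "{s p, s q} \<in> E" if "{p, q} \<in> ?E" "{p, q} \<noteq> {x, y}" "p \<noteq> q" for p q
    using that xy \<open>x \<noteq> y\<close> y[of p] y[of q] y'[of p] y'[of q]
    by (auto simp: s_def doubleton_eq_iff insert_commute split: if_splits)
  let ?uses = "\<lambda>f. f = {a, b} \<or> f = {b, c} \<or> f = {c, d} \<or> f = {d, e}"
  have 1: "?uses {x, y'}"
  proof (rule ccontr)
    assume "\<not> ?uses {x, y'}"
    then have "{a, b} \<in> E" "{b, c} \<in> E" "{c, d} \<in> E" "{d, e} \<in> E"
      using path by (metis insertE)+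
    then show False by (rule p5_freeD[OF free dist])
  qed
  have 2: "?uses {x, y}"
  proof (rule ccontr)
    assume "\<not> ?uses {x, y}"
    moreover have "a \<noteq> b" "b \<noteq> c" "c \<noteq> d" "d \<noteq> e"
      using dist by simp_all
    ultimately have "{s a, s b} \<in> E" "{s b, s c} \<in> E" "{s c, s d} \<in> E" "{s d, s e} \<in> E"
      using path by (metis swap)+
    moreover have "distinct [s a, s b, s c, s d, s e]"
      using dist by (simp add: inj)
    ultimately show False by (rule p5_freeD[OF free, rotated])
  qed
  define F where "F = ?E"
  have y_nbr: "z = x \<or> z = y'" if "{y, z} \<in> F \<or> {z, y} \<in> F" for z
    using that y[of z] \<open>y \<noteq> y'\<close> by (auto simp: F_def doubleton_eq_iff insert_commute)
  have y'_nbr: "z = x \<or> z = y" if "{y', z} \<in> F \<or> {z, y'} \<in> F" for z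
    using that y'[of z] \<open>y \<noteq> y'\<close> by (auto simp: F_def doubleton_eq_iff insert_commute)
  have path_F: "{a, b} \<in> F" "{b, c} \<in> F" "{c, d} \<in> F" "{d, e} \<in> F"
    using path by (simp_all add: F_def)
  note nbrs = y_nbr[of a] y_nbr[of b] y_nbr[of c] y_nbr[of d] y_nbr[of e]
    y'_nbr[of a] y'_nbr[of b] y'_nbr[of c] y'_nbr[of d] y'_nbr[of e]
  show False
    using 1 2 dist path_F nbrs \<open>y \<noteq> y'\<close> by (auto simp: doubleton_eq_iff)
qed

subsection \<open>Connected components\<close>

definition component :: "'a set set \<Rightarrow> 'a \<Rightarrow> 'a set" where
  "component E x = {y. (x, y) \<in> {(a, b). {a, b} \<in> E}\<^sup>*}"

definition components :: "'a set \<Rightarrow> 'a set set \<Rightarrow> 'a set set" where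
  "components V E = component E ` V"

lemma component_refl [simp]: "x \<in> component E x"
  by (simp add: component_def)

lemma component_sym: "y \<in> component E x \<longleftrightarrow> x \<in> component E y"
proof -
  have "sym {(a, b). {a, b} \<in> E}"
    by (auto simp: sym_def insert_commute)
  then show ?thesis
    unfolding component_def using sym_rtrancl symD by fastforce
qed

lemma component_eq: "y \<in> component E x \<Longrightarrow> component E y = component E x"
  using component_sym[of y E x] unfolding component_def by (auto intro: rtrancl_trans)

lemma component_cases: "component E x = component E y \<or> component E x \<inter> component E y = {}"
  using component_eq by (metis disjoint_iff)

lemma component_edge: "{x, y} \<in> E \<Longrightarrow> component E y = component E x"
  by (rule component_eq) (auto simp: component_def)

lemma component_edge_mem: "{x, y} \<in> E \<Longrightarrow> x \<in> component E z \<Longrightarrow> y \<in> component E z"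
  using component_edge component_eq component_refl by metis

text \<open>Applying \<open>rtrancl_insert\<close> to both orientations of the new edge describes
  reachability in the enlarged graph by the old classes of \<open>u\<close>, \<open>v\<close> and
  \<open>x\<close>. Since membership in an old class amounts to equality of classes, the description
  collapses to the two cases of the right-hand side.\<close>

lemma component_insert:
  "component (insert {u, v} E) x =
    (if x \<in> component E u \<union> component E v then component E u \<union> component E v else component E x)"
proof -
  have rel: "{(a, b). {a, b} \<in> insert {u, v} E} = insert (u, v) (insert (v, u) {(a, b). {a, b} \<in> E})"
    by (auto simp: doubleton_eq_iff)
  have "y \<in> component (insert {u, v} E) x \<longleftrightarrow> y \<in> component E x
    \<or> u \<in> component E x \<and> y \<in> component E v \<or> v \<in> component E x \<and> y \<in> component E u
    \<or> u \<in> component E x \<and> y \<in> component E u \<or> v \<in> component E x \<and> y \<in> component E v" for y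
    unfolding component_def rel rtrancl_insert
    by (auto intro: rtrancl_trans)
  moreover have "w \<in> component E x \<longleftrightarrow> component E x = component E w" for w
    using component_eq component_refl by metis
  moreover have "x \<in> component E w \<longleftrightarrow> component E x = component E w" for w
    using component_eq component_refl by metis
  ultimately have "y \<in> component (insert {u, v} E) x \<longleftrightarrow> y \<in> (if x \<in> component E u \<union> component E v
      then component E u \<union> component E v else component E x)" for y
    by (metis Un_iff)
  then show ?thesis by blast
qed

lemma component_subset:
  assumes "E \<subseteq> pairs V" "x \<in> V"
  shows "component E x \<subseteq> V"
proof
  fix y assume "y \<in> component E x"
  then have "(x, y) \<in> {(a, b). {a, b} \<in> E}\<^sup>*" by (simp add: component_def)
  then show "y \<in> V"
    by induction (use assms in \<open>auto dest!: subsetD\<close>)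
qed

text \<open>A walk from a point of \<open>S\<close> to a point of the component outside
  \<open>S\<close> must leave \<open>S\<close> at some step. This cut property is the form in which
  connectedness enters the edge bounds below.\<close>

lemma component_exit:
  assumes "S \<subseteq> component E x" "S \<noteq> {}" "S \<noteq> component E x"
  obtains s t where "s \<in> S" "t \<in> component E x" "t \<notin> S" "{s, t} \<in> E"
proof -
  obtain s t where s: "s \<in> S" and t: "t \<in> component E x" "t \<notin> S"
    using assms by blast
  then have "t \<in> component E s"
    using assms(1) component_eq by (metis subsetD)
  then have "(s, t) \<in> {(a, b). {a, b} \<in> E}\<^sup>*"
    by (simp add: component_def)
  then have "t \<notin> S \<longrightarrow> (\<exists>s\<in>S. \<exists>t. t \<notin> S \<and> {s, t} \<in> E)"
  proof induction
    case (step y z)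
    then show ?case by (cases "y \<in> S") blast+
  qed (use s in simp)
  with t obtain p q where "p \<in> S" "q \<notin> S" "{p, q} \<in> E" by blast
  moreover from this have "q \<in> component E x"
    using assms(1) component_edge_mem by (metis subsetD)
  ultimately show thesis using that by blast
qed

lemma components_disjoint:
  assumes "A \<in> components V E" "B \<in> components V E" "A \<noteq> B"
  shows "A \<inter> B = {}"
  using assms component_cases by (force simp: components_def)

lemma components_eq_component: "C \<in> components V E \<Longrightarrow> x \<in> C \<Longrightarrow> C = component E x"
  using component_eq by (force simp: components_def)

lemma finite_components: "finite V \<Longrightarrow> finite (components V E)"
  by (simp add: components_def)

lemma components_subset: "E \<subseteq> pairs V \<Longrightarrow> C \<in> components V E \<Longrightarrow> C \<subseteq> V"
  using component_subset unfolding components_def by (metis imageE)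

section \<open>The effect of a new edge on the set of components\<close>

lemma components_insert_same:
  assumes "component E u = component E v"
  shows "components V (insert {u, v} E) = components V E"
proof -
  have "component (insert {u, v} E) x = component E x" for x
    using assms component_eq[of x E u] by (auto simp: component_insert)
  then show ?thesis by (simp add: components_def)
qed

lemma components_insert:
  assumes "u \<in> V" "v \<in> V"
  shows "components V (insert {u, v} E) =
    insert (component E u \<union> component E v) (components V E - {component E u, component E v})"
    (is "?L = ?R")
proof
  show "?L \<subseteq> ?R"
    using component_refl by (fastforce simp: components_def component_insert)
  have "component E x \<in> ?L" if "x \<in> V" "component E x \<noteq> component E u" "component E x \<noteq> component E v" for x
    unfolding components_def
  proof (rule image_eqI[of _ _ x])
    have "x \<notin> component E u \<union> component E v"
      using that component_eq by (metis Un_iff)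
    then show "component E x = component (insert {u, v} E) x"
      by (simp add: component_insert)
  qed (use that in simp)
  moreover have "component E u \<union> component E v \<in> ?L"
    unfolding components_def
    by (rule image_eqI[of _ _ u]) (use assms in \<open>auto simp: component_insert\<close>)
  ultimately show "?R \<subseteq> ?L"
    by (auto simp: components_def)
qed

text \<open>A merge removes two summands and adds one. The removed terms are added on the left
  because subtraction on naturals truncates.\<close>

lemma sum_components_insert:
  fixes f :: "'a set \<Rightarrow> nat"
  assumes "finite V" "u \<in> V" "v \<in> V" and ne: "component E u \<noteq> component E v"
  shows "sum f (components V (insert {u, v} E)) + f (component E u) + f (component E v) =
    sum f (components V E) + f (component E u \<union> component E v)"
proof -
  let ?A = "component E u" and ?B = "component E v"
  have mem: "?A \<in> components V E" "?B \<in> components V E"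
    using assms by (auto simp: components_def)
  have fin: "finite (components V E)" using assms by (simp add: finite_components)
  have "?A \<union> ?B \<notin> components V E - {?A, ?B}"
    using mem(1) components_eq_component[of "?A \<union> ?B" V E u] by auto
  then have "sum f (components V (insert {u, v} E)) = f (?A \<union> ?B) + sum f (components V E - {?A, ?B})"
    using assms fin by (simp add: components_insert)
  moreover have "sum f (components V E) = f ?A + (f ?B + sum f (components V E - {?A, ?B}))"
    using mem fin ne
    by (simp add: sum.remove[of _ ?A] sum.remove[of "components V E - {?A}" ?B] Diff_insert2[symmetric])
  ultimately show ?thesis by simp
qed

text \<open>A five-vertex path that was not there before uses the new edge, hence lies in the merged
  component, which is too small for it.\<close>

lemma p5_free_insert_small:
  assumes free: "p5_free E" and fin: "finite (component E u \<union> component E v)"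
    and small: "card (component E u \<union> component E v) \<le> 4"
  shows "p5_free (insert {u, v} E)"
  unfolding p5_free_def
proof (intro allI impI notI)
  fix a b c d e
  let ?E = "insert {u, v} E"
  assume dist: "distinct [a, b, c, d, e]"
    and path: "{a, b} \<in> ?E \<and> {b, c} \<in> ?E \<and> {c, d} \<in> ?E \<and> {d, e} \<in> ?E"
  have sub: "{a, b, c, d, e} \<subseteq> component ?E a"
  proof -
    have "b \<in> component ?E a"
      using path component_edge_mem component_refl by metis
    moreover from this have "c \<in> component ?E a"
      using path component_edge_mem by metis
    moreover from this have "d \<in> component ?E a"
      using path component_edge_mem by metis
    moreover from this have "e \<in> component ?E a"
      using path component_edge_mem by metis
    ultimately show ?thesis by simp
  qed
  have "u \<in> {a, b, c, d, e}"
  proof (rule ccontr)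
    assume "u \<notin> {a, b, c, d, e}"
    then have "{a, b} \<in> E" "{b, c} \<in> E" "{c, d} \<in> E" "{d, e} \<in> E"
      using path by (auto simp: doubleton_eq_iff)
    then show False by (rule p5_freeD[OF free dist])
  qed
  then have "component ?E u = component ?E a"
    using sub component_eq by (metis subsetD)
  then have "{a, b, c, d, e} \<subseteq> component E u \<union> component E v"
    using sub by (simp add: component_insert)
  then have "card {a, b, c, d, e} \<le> 4"
    using card_mono[OF fin] small by (metis le_trans)
  with dist show False by simp
qed

subsection \<open>Edges of a connected \<open>P\<^sub>5\<close>-free graph\<close>

lemma obtain_avoiding:
  assumes "card C \<ge> 5" "finite S" "card S \<le> 4"
  obtains r where "r \<in> C" "r \<notin> S"
proof -
  have "\<not> C \<subseteq> S"
    using assms card_mono[of S C] by linarith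
  then show thesis using that by blast
qed

text \<open>If some vertex were not adjacent to \<open>c\<close>, an edge leaving the closed
  neighbourhood of \<open>c\<close> would give a five-vertex path through the triangle. So
  \<open>c\<close> is adjacent to everything, and any edge off \<open>c\<close> other than
  \<open>{a, b}\<close> again gives such a path: the graph is a star with one extra edge.\<close>

lemma connected_p5_free_triangle:
  assumes free: "p5_free E" and C: "card C \<ge> 5"
    and exit: "\<And>S. S \<subseteq> C \<Longrightarrow> S \<noteq> {} \<Longrightarrow> S \<noteq> C \<Longrightarrow> \<exists>s\<in>S. \<exists>t\<in>C - S. {s, t} \<in> E"
    and tri: "a \<in> C" "b \<in> C" "c \<in> C" "distinct [a, b, c]"
      "{a, b} \<in> E" "{b, c} \<in> E" "{a, c} \<in> E"
    and r: "{c, r} \<in> E" "r \<in> C" "r \<notin> {a, b, c}"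
    and pq: "{p, q} \<in> E" "p \<in> C" "q \<in> C" "p \<noteq> q"
  shows "p = c \<or> q = c \<or> {p, q} = {a, b}"
proof -
  note path = p5_freeD[OF free]
  have nbr: "{c, w} \<in> E" if "w \<in> C" "w \<noteq> c" for w
  proof (rule ccontr)
    assume "{c, w} \<notin> E"
    let ?S = "{w \<in> C. w = c \<or> {c, w} \<in> E}"
    have "?S \<noteq> C" "?S \<noteq> {}"
      using that \<open>{c, w} \<notin> E\<close> tri by auto
    then obtain s t where st: "s \<in> ?S" "t \<in> C" "t \<notin> ?S" "{s, t} \<in> E"
      using exit[of ?S] by blast
    have t: "t \<notin> {a, b, c, r}" and "s \<noteq> c"
      using st tri r by (auto simp: insert_commute)
    consider "s = a" | "s = b" | "s \<notin> {a, b, c}"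
      using \<open>s \<noteq> c\<close> by blast
    then show False
    proof cases
      case 1
      then show False
        using path[of r c b a t] st t tri r by (auto simp: insert_commute)
    next
      case 2
      then show False
        using path[of r c a b t] st t tri r by (auto simp: insert_commute)
    next
      case 3
      then show False
        using path[of t s c a b] st t tri by (auto simp: insert_commute)
    qed
  qed
  have tip: False if "{s, t} \<in> E" "s = a \<or> s = b" "t \<in> C" "t \<notin> {a, b, c}" for s t
  proof -
    \<comment> \<open>A fifth vertex \<open>r'\<close> is adjacent to \<open>c\<close>, which makes
      \<open>r' c b a t\<close> or \<open>r' c a b t\<close> a path. On four vertices a complete
      graph would be possible, so the bound on \<open>card C\<close> is essential here.\<close>
    have "card {a, b, c, t} \<le> 4"
      by (simp add: card_insert_if)
    then obtain r' where "r' \<in> C" "r' \<notin> {a, b, c, t}"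
      using obtain_avoiding[OF C, of "{a, b, c, t}"] by auto
    then show False
      using that nbr[of r'] tri path[of r' c b a t] path[of r' c a b t]
      by (auto simp: insert_commute)
  qed
  have "\<not> (p \<notin> {a, b, c} \<and> q \<notin> {a, b, c})"
    using pq nbr[of q] tri path[of p q c a b] by (auto simp: insert_commute)
  then show ?thesis
    using tip[of p q] tip[of q p] pq by (auto simp: insert_commute)
qed

text \<open>First \<open>{u, v}\<close> dominates \<open>C\<close>. An edge missing both
  \<open>u\<close> and \<open>v\<close> would then create a triangle or close \<open>w u v z\<close>
  to a 4-cycle, and a fifth vertex attached to \<open>u\<close> or \<open>v\<close> would extend the
  cycle to a forbidden path. So the graph is a double star.\<close>

lemma connected_p5_free_path:
  assumes free: "p5_free E" and C: "card C \<ge> 5"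
    and exit: "\<And>S. S \<subseteq> C \<Longrightarrow> S \<noteq> {} \<Longrightarrow> S \<noteq> C \<Longrightarrow> \<exists>s\<in>S. \<exists>t\<in>C - S. {s, t} \<in> E"
    and no_tri: "\<And>a b c. {a, b} \<in> E \<Longrightarrow> {b, c} \<in> E \<Longrightarrow> {a, c} \<in> E \<Longrightarrow> {a, b, c} \<subseteq> C \<Longrightarrow>
      distinct [a, b, c] \<Longrightarrow> False"
    and path: "{w, u} \<in> E" "{u, v} \<in> E" "{v, z} \<in> E" "distinct [w, u, v, z]"
      "w \<in> C" "u \<in> C" "v \<in> C" "z \<in> C"
    and pq: "{p, q} \<in> E" "p \<in> C" "q \<in> C" "p \<noteq> q"
  shows "p \<in> {u, v} \<or> q \<in> {u, v}"
proof (rule ccontr)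
  assume out: "\<not> (p \<in> {u, v} \<or> q \<in> {u, v})"
  note path5 = p5_freeD[OF free]
  let ?S = "{x \<in> C. x \<in> {u, v} \<or> {x, u} \<in> E \<or> {x, v} \<in> E}"
  have S: "x \<in> ?S" if "x \<in> C" for x
  proof (rule ccontr)
    assume "x \<notin> ?S"
    then have "?S \<noteq> C" using that by blast
    moreover have "?S \<noteq> {}" using path by blast
    ultimately obtain s t where st: "s \<in> ?S" "t \<in> C" "t \<notin> ?S" "{s, t} \<in> E"
      using exit[of ?S] by blast
    have t: "t \<notin> {w, u, v, z}" and s: "s \<notin> {u, v}" and "s \<noteq> t"
      using st path by (auto simp: insert_commute)
    \<comment> \<open>The paths to be refuted are \<open>t s u v z\<close> and
      \<open>t s v u w\<close>; the absence of triangles keeps \<open>s\<close> distinct from their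
      last vertex.\<close>
    have "{s, u} \<in> E \<Longrightarrow> s \<noteq> z"
      using no_tri[of z u v] path by (auto simp: insert_commute)
    moreover have "{s, v} \<in> E \<Longrightarrow> s \<noteq> w"
      using no_tri[of w u v] path by (auto simp: insert_commute)
    moreover have "{s, u} \<in> E \<or> {s, v} \<in> E"
      using st s by auto
    moreover have "{s, u} \<in> E \<Longrightarrow> s \<noteq> z \<Longrightarrow> False"
      using path5[of t s u v z] st s t \<open>s \<noteq> t\<close> path by (simp add: insert_commute)
    moreover have "{s, v} \<in> E \<Longrightarrow> s \<noteq> w \<Longrightarrow> False"
      using path5[of t s v u w] st s t \<open>s \<noteq> t\<close> path by (auto simp: insert_commute)
    ultimately show False by blast
  qed
  have far: False if "{a, b} \<in> E" "a \<in> C" "b \<in> C" "a \<noteq> b" "a \<notin> {u, v}" "b \<notin> {u, v}" "{a, u} \<in> E" for a b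
  proof -
    have "a \<noteq> z"
      using no_tri[of z u v] path that by (auto simp: insert_commute)
    then have "b = z"
      using path5[of b a u v z] that path by (auto simp: insert_commute)
    then have "a = w"
      using path5[of w u v z a] that path \<open>a \<noteq> z\<close> by (auto simp: insert_commute)
    \<comment> \<open>At this point \<open>w u v z\<close> is a 4-cycle, and a path entering it from
      a fifth vertex can run through all four of its vertices.\<close>
    have "card {w, u, v, z} \<le> 4"
      by (simp add: card_insert_if)
    then obtain r where r: "r \<in> C" "r \<notin> {w, u, v, z}"
      using obtain_avoiding[OF C, of "{w, u, v, z}"] by auto
    then have "{r, u} \<in> E \<or> {r, v} \<in> E"
      using S[of r] by auto
    then show False
      using r path that \<open>b = z\<close> \<open>a = w\<close> path5[of r u v z w] path5[of r v u w z]
      by (auto simp: insert_commute)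
  qed
  have far': False if "{a, b} \<in> E" "a \<in> C" "b \<in> C" "a \<noteq> b" "a \<notin> {u, v}" "b \<notin> {u, v}" "{a, v} \<in> E" for a b
  proof -
    have "{b, u} \<notin> E"
      using that far[of b a] by (auto simp: insert_commute)
    then have "{b, v} \<in> E"
      using that S[of b] by auto
    then show False
      using no_tri[of a b v] that path by (auto simp: insert_commute)
  qed
  show False
    using far[of p q] far'[of p q] S[of p] pq out by auto
qed

text \<open>A neighbour of \<open>u\<close> with an edge to a non-neighbour would start a
  four-vertex path through \<open>t\<close> or \<open>v\<close>, so \<open>u\<close> is adjacent to
  everything. An edge off \<open>u\<close> would then form a triangle.\<close>

lemma connected_p5_free_star:
  assumes exit: "\<And>S. S \<subseteq> C \<Longrightarrow> S \<noteq> {} \<Longrightarrow> S \<noteq> C \<Longrightarrow> \<exists>s\<in>S. \<exists>t\<in>C - S. {s, t} \<in> E"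
    and no_tri: "\<And>a b c. {a, b} \<in> E \<Longrightarrow> {b, c} \<in> E \<Longrightarrow> {a, c} \<in> E \<Longrightarrow> {a, b, c} \<subseteq> C \<Longrightarrow>
      distinct [a, b, c] \<Longrightarrow> False"
    and no_path: "\<And>a b c d. {a, b} \<in> E \<Longrightarrow> {b, c} \<in> E \<Longrightarrow> {c, d} \<in> E \<Longrightarrow> {a, b, c, d} \<subseteq> C \<Longrightarrow>
      distinct [a, b, c, d] \<Longrightarrow> False"
    and cherry: "{t, u} \<in> E" "{u, v} \<in> E" "distinct [t, u, v]" "t \<in> C" "u \<in> C" "v \<in> C"
    and pq: "{p, q} \<in> E" "p \<in> C" "q \<in> C" "p \<noteq> q"
  shows "p = u \<or> q = u"
proof (rule ccontr)
  assume out: "\<not> (p = u \<or> q = u)"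
  let ?S = "{x \<in> C. x = u \<or> {x, u} \<in> E}"
  have S: "x \<in> ?S" if "x \<in> C" for x
  proof (rule ccontr)
    assume "x \<notin> ?S"
    then have "?S \<noteq> C" "?S \<noteq> {}"
      using that cherry by auto
    then obtain s y where sy: "s \<in> ?S" "y \<in> C" "y \<notin> ?S" "{s, y} \<in> E"
      using exit[of ?S] by blast
    have "y \<notin> {t, u, v}" "s \<noteq> u" "s \<noteq> y"
      using sy cherry by (auto simp: insert_commute)
    then show False
      using sy cherry no_path[of y s u t] no_path[of y s u v] by (auto simp: insert_commute)
  qed
  show False
    using S[of p] S[of q] no_tri[of p q u] pq out cherry by (auto simp: insert_commute)
qed

text \<open>A triangle forces a star with one extra edge, a four-vertex path without triangles
  forces a double star, and otherwise the graph is a star. In each case some map \<open>g\<close> on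
  \<open>C\<close> reaches every edge, so there are at most \<open>card C\<close> of them.\<close>

lemma connected_p5_free_card_edges:
  assumes free: "p5_free E" and C: "card C \<ge> 5" and E: "E \<subseteq> pairs V"
    and exit: "\<And>S. S \<subseteq> C \<Longrightarrow> S \<noteq> {} \<Longrightarrow> S \<noteq> C \<Longrightarrow> \<exists>s\<in>S. \<exists>t\<in>C - S. {s, t} \<in> E"
  shows "card {e \<in> E. e \<subseteq> C} \<le> card C"
proof -
  have fin: "finite C"
    using C card.infinite by fastforce
  have bound: ?thesis if "\<And>p q. {p, q} \<in> E \<Longrightarrow> p \<in> C \<Longrightarrow> q \<in> C \<Longrightarrow> p \<noteq> q \<Longrightarrow> {p, q} \<in> g ` C" for g
  proof -
    have "{e \<in> E. e \<subseteq> C} \<subseteq> g ` C"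
    proof clarify
      fix e assume "e \<in> E" "e \<subseteq> C"
      moreover from this obtain p q where "e = {p, q}" "p \<noteq> q"
        using E pairsE by (metis subsetD)
      ultimately show "e \<in> g ` C"
        using that[of p q] by simp
    qed
    then have "card {e \<in> E. e \<subseteq> C} \<le> card (g ` C)"
      using fin by (intro card_mono) auto
    also have "\<dots> \<le> card C"
      using fin by (rule card_image_le)
    finally show ?thesis .
  qed
  define tri where "tri a b c \<longleftrightarrow>
    {a, b} \<in> E \<and> {b, c} \<in> E \<and> {a, c} \<in> E \<and> {a, b, c} \<subseteq> C \<and> distinct [a, b, c]" for a b c
  define path where "path a b c d \<longleftrightarrow>
    {a, b} \<in> E \<and> {b, c} \<in> E \<and> {c, d} \<in> E \<and> {a, b, c, d} \<subseteq> C \<and> distinct [a, b, c, d]" for a b c d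
  have no_tri: "False" if "\<not> tri a b c" "{a, b} \<in> E" "{b, c} \<in> E" "{a, c} \<in> E"
    "{a, b, c} \<subseteq> C" "distinct [a, b, c]" for a b c
    using that by (simp add: tri_def)
  have no_path: "False" if "\<not> path a b c d" "{a, b} \<in> E" "{b, c} \<in> E" "{c, d} \<in> E"
    "{a, b, c, d} \<subseteq> C" "distinct [a, b, c, d]" for a b c d
    using that by (simp add: path_def)
  consider (triangle) a b c where "tri a b c"
    | (path) a b c d where "path a b c d" "\<And>a b c. \<not> tri a b c"
    | (star) "\<And>a b c d. \<not> path a b c d" "\<And>a b c. \<not> tri a b c"
    by blast
  then show ?thesis
  proof cases
    case triangle
    \<comment> \<open>The edge leaving the triangle may start at any corner; stating this case for
      arbitrary \<open>a b c r\<close> lets that corner play the role of the centre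
      \<open>c\<close>.\<close>
    have star: ?thesis if abc: "{a, b} \<in> E" "{b, c} \<in> E" "{a, c} \<in> E" "a \<in> C" "b \<in> C" "c \<in> C" "distinct [a, b, c]"
      and r: "{c, r} \<in> E" "r \<in> C" "r \<notin> {a, b, c}" for a b c r
    proof (rule bound)
      fix p q assume "{p, q} \<in> E" "p \<in> C" "q \<in> C" "p \<noteq> q"
      with connected_p5_free_triangle[OF free C exit abc(4-7,1-3) r this]
      show "{p, q} \<in> (\<lambda>x. if x = c then {a, b} else {c, x}) ` C"
        using abc by (auto simp: image_iff insert_commute)
    qed
    note triangle = triangle[unfolded tri_def]
    have "{a, b, c} \<noteq> C"
      using C triangle by auto
    then obtain s r where "s \<in> {a, b, c}" "r \<in> C - {a, b, c}" "{s, r} \<in> E"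
      using exit[of "{a, b, c}"] triangle by blast
    then consider "{a, r} \<in> E" | "{b, r} \<in> E" | "{c, r} \<in> E" by blast
    moreover have "distinct [b, c, a]" "distinct [a, c, b]"
      using triangle by auto
    ultimately show ?thesis
    proof cases
      case 1
      show ?thesis
        by (rule star[of b c a r]) (use triangle 1 \<open>distinct [b, c, a]\<close> \<open>r \<in> C - {a, b, c}\<close> in \<open>simp_all add: insert_commute\<close>)
    next
      case 2
      show ?thesis
        by (rule star[of a c b r]) (use triangle 2 \<open>distinct [a, c, b]\<close> \<open>r \<in> C - {a, b, c}\<close> in \<open>simp_all add: insert_commute\<close>)
    next
      case 3
      show ?thesis
        by (rule star[of a b c r]) (use triangle 3 \<open>r \<in> C - {a, b, c}\<close> in simp_all)
    qed
  next
    case path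
    note path4 = path(1)[unfolded path_def]
    show ?thesis
    proof (rule bound)
      fix p q assume pq: "{p, q} \<in> E" "p \<in> C" "q \<in> C" "p \<noteq> q"
      have "p \<in> {b, c} \<or> q \<in> {b, c}"
        by (rule connected_p5_free_path[OF free C exit no_tri[OF path(2)], where w = a and z = d])
          (use path4 pq in auto)
      moreover have "{p, b} \<in> E \<Longrightarrow> {p, c} \<in> E \<Longrightarrow> p \<in> {b, c}" "{q, b} \<in> E \<Longrightarrow> {q, c} \<in> E \<Longrightarrow> q \<in> {b, c}"
        using no_tri[OF path(2), of p b c] no_tri[OF path(2), of q b c] path4 pq by auto
      \<comment> \<open>Without triangles a leaf has only one edge, at \<open>b\<close> or at
        \<open>c\<close>, and represents it; \<open>b\<close> represents the middle edge.\<close>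
      ultimately show "{p, q} \<in> (\<lambda>x. if x = b then {b, c} else if {x, b} \<in> E then {x, b} else {x, c}) ` C"
        using pq path4 by (auto simp: image_iff insert_commute doubleton_eq_iff)
    qed
  next
    case star
    obtain x where "x \<in> C"
      using C by fastforce
    moreover have "{x} \<noteq> C"
      using C by auto
    ultimately obtain y where y: "y \<in> C" "y \<noteq> x" "{x, y} \<in> E"
      using exit[of "{x}"] by blast
    have "{x, y} \<noteq> C"
      using C y by auto
    then obtain t where t: "t \<in> C" "t \<notin> {x, y}" "{x, t} \<in> E \<or> {y, t} \<in> E"
      using exit[of "{x, y}"] y \<open>x \<in> C\<close> by blast
    have cherry: ?thesis if "{t, u} \<in> E" "{u, v} \<in> E" "distinct [t, u, v]" "t \<in> C" "u \<in> C" "v \<in> C" for t u v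
    proof (rule bound)
      fix p q assume pq: "{p, q} \<in> E" "p \<in> C" "q \<in> C" "p \<noteq> q"
      have "p = u \<or> q = u"
        by (rule connected_p5_free_star[where C = C and E = E and t = t and v = v])
          (fact exit no_tri[OF star(2)] no_path[OF star(1)] that pq)+
      with pq show "{p, q} \<in> (\<lambda>x. {u, x}) ` C"
        by (auto simp: image_iff insert_commute)
    qed
    show ?thesis
      using t y \<open>x \<in> C\<close> cherry[of t x y] cherry[of t y x] by (auto simp: insert_commute)
  qed
qed

text \<open>Up to four vertices the binomial coefficients 0, 0, 1, 3, 6 suffice. Only the last
  exceeds the number of vertices, and by two, whence the correction term.\<close>

lemma card_component_edges:
  assumes free: "p5_free E" and fin: "finite V" and E: "E \<subseteq> pairs V" and C: "C \<in> components V E"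
  shows "card {e \<in> E. e \<subseteq> C} \<le> card C + (if card C = 4 then 2 else 0)"
proof (cases "card C \<le> 4")
  case True
  have "finite C"
    using components_subset[OF E C] fin finite_subset by blast
  then have "card {e \<in> E. e \<subseteq> C} \<le> card (pairs C)"
    using E by (intro card_mono finite_pairs) (auto simp: pairs_def)
  also have "\<dots> = card C choose 2"
    using n_subsets[OF \<open>finite C\<close>, of 2] by (simp add: pairs_def)
  also have "\<dots> \<le> card C + (if card C = 4 then 2 else 0)"
  proof -
    consider "card C = 0" | "card C = 1" | "card C = 2" | "card C = 3" | "card C = 4"
      using True by linarith
    then show ?thesis
      by cases (simp_all add: choose_two)
  qed
  finally show ?thesis .
next
  case False
  obtain x where x: "C = component E x"
    using C by (auto simp: components_def)
  have "card {e \<in> E. e \<subseteq> C} \<le> card C"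
  proof (rule connected_p5_free_card_edges[OF free _ E])
    fix S assume "S \<subseteq> C" "S \<noteq> {}" "S \<noteq> C"
    then show "\<exists>s\<in>S. \<exists>t\<in>C - S. {s, t} \<in> E"
      unfolding x by (rule component_exit) blast
  qed (use False in simp)
  then show ?thesis by simp
qed

section \<open>Summation over all components\<close>

lemma sum_card_components:
  assumes fin: "finite V" and E: "E \<subseteq> pairs V"
  shows "sum card (components V E) = card V"
proof -
  have "\<Union> (components V E) = V"
    using component_subset[OF E] component_refl by (fastforce simp: components_def)
  moreover have "pairwise disjnt (components V E)"
    unfolding pairwise_def disjnt_def using components_disjoint by metis
  moreover have "finite C" if "C \<in> components V E" for C
    using components_subset[OF E that] fin finite_subset by blast
  ultimately show ?thesis
    using card_Union_disjoint[of "components V E"] by simp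
qed

lemma card_edges_le:
  assumes free: "p5_free E" and fin: "finite V" and E: "E \<subseteq> pairs V"
  shows "card E \<le> card V + 2 * card {C \<in> components V E. card C = 4}"
proof -
  have fin_comps: "finite (components V E)"
    using fin by (rule finite_components)
  have "E \<subseteq> (\<Union>C\<in>components V E. {e \<in> E. e \<subseteq> C})"
  proof
    fix e assume "e \<in> E"
    moreover from this obtain a b where ab: "e = {a, b}" "a \<in> V"
      using E pairsE by (metis subsetD)
    ultimately have "e \<subseteq> component E a"
      using component_edge_mem[of a b E a] by simp
    with \<open>e \<in> E\<close> ab(2) show "e \<in> (\<Union>C\<in>components V E. {e \<in> E. e \<subseteq> C})"
      by (auto simp: components_def)
  qed
  moreover have "finite E"
    using E fin finite_pairs finite_subset by blast
  ultimately have "card E \<le> card (\<Union>C\<in>components V E. {e \<in> E. e \<subseteq> C})"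
    using fin_comps by (intro card_mono) auto
  also have "\<dots> \<le> (\<Sum>C\<in>components V E. card {e \<in> E. e \<subseteq> C})"
    using fin_comps by (rule card_UN_le)
  also have "\<dots> \<le> (\<Sum>C\<in>components V E. card C + (if card C = 4 then 2 else 0))"
    using card_component_edges[OF free fin E] by (intro sum_mono)
  also have "\<dots> = card V + 2 * card {C \<in> components V E. card C = 4}"
    using fin_comps sum_card_components[OF fin E] by (simp add: sum.distrib sum.If_cases Int_def)
  finally show ?thesis .
qed

subsection \<open>Strategies given by an invariant\<close>

text \<open>The two optima under one name, so that a single invariant lemma serves both
  players.\<close>

fun opt :: "player \<Rightarrow> nat set \<Rightarrow> nat" where
  "opt Prolonger A = Max A"
| "opt Shortener A = Min A"

lemma game_value_step:
  assumes "finite (edges H)" "simple_graph H" "E \<subseteq> edges H" "free \<F> (verts H, E)"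
  shows "game_value \<F> H p E = (if legal_moves \<F> H E = {} then card E
    else opt p ((\<lambda>e. game_value \<F> H (opponent p) (insert e E)) ` legal_moves \<F> H E))"
  using assms by (subst game_value.simps, cases p) (simp_all add: saturated_iff_legal_moves_empty)

text \<open>The player \<open>s\<close> keeps \<open>J\<close>, possibly broken by the opponent for
  the length of one move; the last hypothesis covers both kinds of position, and
  \<open>choice\<close> says that the optimum of \<open>s\<close> is as good for \<open>Q\<close> as
  any available value. The induction is on the number of edges not yet played.\<close>

lemma game_value_invariant:
  assumes H: "finite (edges H)" "simple_graph H"
    and choice: "\<And>A a. finite A \<Longrightarrow> a \<in> A \<Longrightarrow> Q a \<Longrightarrow> Q (opt s A)"
    and final: "\<And>E. E \<subseteq> edges H \<Longrightarrow> free \<F> (verts H, E) \<Longrightarrow> J E \<Longrightarrow> legal_moves \<F> H E = {} \<Longrightarrow> Q (card E)"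
    and move: "\<And>E. E \<subseteq> edges H \<Longrightarrow> free \<F> (verts H, E) \<Longrightarrow> J E \<Longrightarrow> legal_moves \<F> H E \<noteq> {} \<Longrightarrow>
      \<exists>e\<in>legal_moves \<F> H E. J (insert e E)"
    and reply: "\<And>E e. E \<subseteq> edges H \<Longrightarrow> free \<F> (verts H, E) \<Longrightarrow> J E \<Longrightarrow> e \<in> legal_moves \<F> H E \<Longrightarrow>
      J (insert e E) \<or> (\<exists>e'\<in>legal_moves \<F> H (insert e E). J (insert e' (insert e E)))"
    and E: "E \<subseteq> edges H" "free \<F> (verts H, E)"
    and J: "J E \<or> p = s \<and> (\<exists>e\<in>legal_moves \<F> H E. J (insert e E))"
  shows "Q (game_value \<F> H p E)"
  using E J
proof (induction "card (edges H - E)" arbitrary: p E rule: less_induct)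
  case less
  let ?M = "legal_moves \<F> H E"
  let ?val = "\<lambda>e. game_value \<F> H (opponent p) (insert e E)"
  have M: "insert e E \<subseteq> edges H" "free \<F> (verts H, insert e E)"
    "card (edges H - insert e E) < card (edges H - E)" if "e \<in> ?M" for e
  proof -
    have "edges H - insert e E \<subset> edges H - E"
      using that by (auto simp: legal_moves_def)
    then show "card (edges H - insert e E) < card (edges H - E)"
      using H by (simp add: psubset_card_mono)
  qed (use that less.prems in \<open>auto simp: legal_moves_def\<close>)
  have fin: "finite ?M"
    using H by (simp add: legal_moves_def)
  show ?case
  proof (cases "?M = {}")
    case True
    \<comment> \<open>With no legal move the second alternative for \<open>J\<close> is impossible,
      so \<open>J E\<close> itself holds.\<close>
    then show ?thesis
      using less.prems final game_value_step[OF H less.prems(1,2)] by auto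
  next
    case False
    have "Q (opt p (?val ` ?M))"
    proof (cases "p = s")
      case True
      then obtain e where e: "e \<in> ?M" "J (insert e E)"
        using less.prems move False by blast
      then have "Q (?val e)"
        using less.hyps M by blast
      then show ?thesis
        using choice[of "?val ` ?M" "?val e"] e fin True by blast
    next
      case False
      then have s: "opponent p = s"
        by (cases p; cases s) simp_all
      have all: "Q (?val e)" if "e \<in> ?M" for e
        using less.hyps[OF M(3)[OF that] M(1,2)[OF that], of "opponent p"] reply less.prems that s False by blast
      \<comment> \<open>The opponent's optimum is attained at some move, and all moves lead to
        values satisfying \<open>Q\<close>.\<close>
      have "opt p (?val ` ?M) \<in> ?val ` ?M"
        using fin \<open>?M \<noteq> {}\<close> by (cases p) (simp_all only: opt.simps Max_in Min_in finite_imageI image_is_empty not_False_eq_True)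
      then obtain e where "e \<in> ?M" "opt p (?val ` ?M) = ?val e"
        by (rule imageE)
      with all[of e] show ?thesis by simp
    qed
    then show ?thesis
      using False game_value_step[OF H less.prems(1,2)] by auto
  qed
qed

section \<open>The game on a complete graph\<close>

definition moves :: "'a set \<Rightarrow> 'a set set \<Rightarrow> 'a set set" where
  "moves V E = {e \<in> pairs V - E. p5_free (insert e E)}"

lemma legal_moves_eq_moves:
  assumes "E \<subseteq> pairs {..<n}"
  shows "legal_moves {path_graph 5} (complete_graph n) E = moves {..<n} E"
  using assms free_path_graph_5_iff[of "insert _ E" "{..<n}"]
  by (auto simp: legal_moves_def moves_def edges_complete_graph verts_complete_graph)

lemma simple_graph_complete_graph: "simple_graph (complete_graph n)"
  by (simp add: simple_graph_def complete_graph_def)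

lemma game_sat_complete_graph_invariant:
  assumes choice: "\<And>A a. finite A \<Longrightarrow> a \<in> A \<Longrightarrow> Q a \<Longrightarrow> Q (opt s A)"
    and final: "\<And>E. E \<subseteq> pairs {..<n} \<Longrightarrow> p5_free E \<Longrightarrow> J E \<Longrightarrow> moves {..<n} E = {} \<Longrightarrow> Q (card E)"
    and move: "\<And>E. E \<subseteq> pairs {..<n} \<Longrightarrow> p5_free E \<Longrightarrow> J E \<Longrightarrow> moves {..<n} E \<noteq> {} \<Longrightarrow>
      \<exists>e\<in>moves {..<n} E. J (insert e E)"
    and reply: "\<And>E e. E \<subseteq> pairs {..<n} \<Longrightarrow> p5_free E \<Longrightarrow> J E \<Longrightarrow> e \<in> moves {..<n} E \<Longrightarrow>
      J (insert e E) \<or> (\<exists>e'\<in>moves {..<n} (insert e E). J (insert e' (insert e E)))"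
    and J: "J {}"
  shows "Q (game_sat p (complete_graph n) {path_graph 5})"
  unfolding game_sat_def
proof (rule game_value_invariant[where J = J and s = s and Q = Q])
  show "finite (edges (complete_graph n))"
    by (simp add: edges_complete_graph finite_pairs)
  show "simple_graph (complete_graph n)"
    by (rule simple_graph_complete_graph)
  show "{} \<subseteq> edges (complete_graph n)" by simp
  show "free {path_graph 5} (verts (complete_graph n), {})"
    by (simp add: free_path_graph_5_iff[of _ "verts (complete_graph n)"] p5_free_def)
  show "J {} \<or> p = s \<and> (\<exists>e\<in>legal_moves {path_graph 5} (complete_graph n) {}. J (insert e {}))"
    using J by simp
  fix E
  assume E: "E \<subseteq> edges (complete_graph n)" "free {path_graph 5} (verts (complete_graph n), E)"
    and JE: "J E"
  have E': "E \<subseteq> pairs {..<n}" "p5_free E"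
    using E free_path_graph_5_iff by (auto simp: edges_complete_graph verts_complete_graph)
  note eqs = legal_moves_eq_moves[OF E'(1)]
  show "Q (card E)" if "legal_moves {path_graph 5} (complete_graph n) E = {}"
    using final[OF E' JE] that eqs by simp
  show "\<exists>e\<in>legal_moves {path_graph 5} (complete_graph n) E. J (insert e E)"
    if "legal_moves {path_graph 5} (complete_graph n) E \<noteq> {}"
    using move[OF E' JE] that eqs by simp
  fix e assume e: "e \<in> legal_moves {path_graph 5} (complete_graph n) E"
  then have "insert e E \<subseteq> pairs {..<n}"
    using E' eqs by (simp add: moves_def)
  then show "J (insert e E) \<or>
      (\<exists>e'\<in>legal_moves {path_graph 5} (complete_graph n) (insert e E). J (insert e' (insert e E)))"
    using reply[OF E' JE, of e] e eqs by (simp add: legal_moves_eq_moves)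
qed (fact choice)

lemma movesE:
  assumes "e \<in> moves V E"
  obtains u v where "e = {u, v}" "u \<in> V" "v \<in> V" "u \<noteq> v" "{u, v} \<notin> E" "p5_free (insert {u, v} E)"
  using assms by (auto simp: moves_def elim: pairsE)

lemma merge_small_move:
  assumes "p5_free E" "finite V" "E \<subseteq> pairs V" "u \<in> V" "v \<in> V"
    and "component E u \<noteq> component E v" "card (component E u) + card (component E v) \<le> 4"
  shows "{u, v} \<in> moves V E"
proof -
  have "finite (component E u \<union> component E v)"
    using assms component_subset finite_subset by (metis finite_UnI)
  moreover have "card (component E u \<union> component E v) \<le> 4"
    using card_Un_le[of "component E u" "component E v"] assms by linarith
  moreover have "{u, v} \<notin> E"
    using assms component_edge by metis
  ultimately show ?thesis
    using assms p5_free_insert_small[of E u v] by (auto simp: moves_def)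
qed

lemma singleton_component_no_edge:
  assumes "E \<subseteq> pairs V" "card (component E z) = 1"
  shows "{z, w} \<notin> E"
proof
  assume "{z, w} \<in> E"
  moreover obtain x where "component E z = {x}"
    using assms card_1_singletonE by metis
  ultimately have "w = z"
    using component_edge_mem component_refl by (metis singletonD)
  with \<open>{z, w} \<in> E\<close> show False
    using assms(1) pairs_iff by (metis subsetD)
qed

subsection \<open>Shortener's strategy\<close>

definition size_count :: "'a set \<Rightarrow> 'a set set \<Rightarrow> nat \<Rightarrow> nat" where
  "size_count V E j = card {C \<in> components V E. card C = j}"

lemma size_count_merge:
  assumes "finite V" "E \<subseteq> pairs V" "u \<in> V" "v \<in> V" "component E u \<noteq> component E v"
  shows "size_count V (insert {u, v} E) j
      + of_bool (card (component E u) = j) + of_bool (card (component E v) = j)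
    = size_count V E j + of_bool (card (component E u) + card (component E v) = j)"
proof -
  have count: "size_count V F j = (\<Sum>C\<in>components V F. of_bool (card C = j))" for F
    using finite_components[OF assms(1)] by (simp add: size_count_def Int_def)
  have "finite (component E w)" if "w \<in> V" for w
    using component_subset assms that finite_subset by metis
  then have "card (component E u \<union> component E v) = card (component E u) + card (component E v)"
    using assms component_cases by (metis card_Un_disjoint)
  then show ?thesis
    using sum_components_insert[OF assms(1,3-5), of "\<lambda>C. of_bool (card C = j)"]
    by (simp add: count)
qed

lemma size_count_obtain:
  assumes "size_count V E j > 0"
  obtains u where "u \<in> V" "card (component E u) = j"
proof -
  have "{C \<in> components V E. card C = j} \<noteq> {}"
    using assms unfolding size_count_def by (metis card.empty less_irrefl)
  then show thesis
    using that by (auto simp: components_def)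
qed

lemma size_count_obtain_two:
  assumes "size_count V E j \<ge> 2"
  obtains u v where "u \<in> V" "card (component E u) = j" "v \<in> V" "card (component E v) = j"
    "component E u \<noteq> component E v"
proof -
  let ?S = "{C \<in> components V E. card C = j}"
  have "card ?S \<ge> 2"
    using assms by (simp add: size_count_def)
  moreover from this have "finite ?S"
    using card.infinite[of ?S] by linarith
  ultimately have "\<exists>C\<in>?S. \<exists>D\<in>?S. C \<noteq> D"
    using card_le_Suc0_iff_eq[of ?S] by auto
  then show thesis
    using that by (auto simp: components_def)
qed

lemma card_component_pos:
  assumes "finite V" "E \<subseteq> pairs V" "u \<in> V"
  shows "card (component E u) > 0"
  using assms component_subset component_refl
  by (metis card_gt_0_iff empty_iff finite_subset)

text \<open>A component on four vertices arises from a singleton or from two components on two vertices,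
  so \<open>shortener_weight\<close> never increases, whatever edges are added, and half of it bounds the number
  of four-vertex components at the end.\<close>

definition shortener_weight :: "'a set \<Rightarrow> 'a set set \<Rightarrow> nat" where
  "shortener_weight V E = 2 * size_count V E 4 + 2 * size_count V E 1 + size_count V E 2"

text \<open>The first alternative is the endgame and persists whatever is played; the second is what
  Shortener maintains until then. Either one allows at most one four-vertex component.\<close>

definition shortener_safe :: "'a set \<Rightarrow> 'a set set \<Rightarrow> bool" where
  "shortener_safe V E \<longleftrightarrow>
    shortener_weight V E \<le> 3 \<or> size_count V E 4 = 0 \<and> size_count V E 2 \<le> 1"

lemma shortener_weight_insert_le:
  assumes "finite V" "E \<subseteq> pairs V" "u \<in> V" "v \<in> V"
  shows "shortener_weight V (insert {u, v} E) \<le> shortener_weight V E"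
proof (cases "component E u = component E v")
  case True
  then show ?thesis
    by (simp add: shortener_weight_def size_count_def components_insert_same)
next
  case False
  \<comment> \<open>The tight merges are 1 + 3 and 2 + 2, which give up weight 2 and gain weight
    2.\<close>
  note count = size_count_merge[OF assms False]
  show ?thesis
    using count[of 1] count[of 2] count[of 4] card_component_pos[OF assms(1,2)] assms(3,4)
    unfolding shortener_weight_def
    by (auto simp: of_bool_def split: if_splits)
qed

text \<open>At weight at most 3 any move will do. Above it there are singletons to spare: two of
  them are joined, or one is attached to the only two-vertex component. These merges involve at most
  three vertices and are therefore legal.\<close>

lemma shortener_move:
  assumes "p5_free E" "finite V" "E \<subseteq> pairs V" and safe: "shortener_safe V E" and "moves V E \<noteq> {}"
  shows "\<exists>e\<in>moves V E. shortener_safe V (insert e E)"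
proof -
  note merge = merge_small_move[OF assms(1-3)] and count = size_count_merge[OF assms(2,3)]
  consider "shortener_weight V E \<le> 3"
    | "size_count V E 4 = 0" "size_count V E 2 = 0" "size_count V E 1 \<ge> 2"
    | "size_count V E 4 = 0" "size_count V E 2 = 1" "size_count V E 1 \<ge> 1"
    using safe unfolding shortener_safe_def shortener_weight_def by linarith
  then show ?thesis
  proof cases
    case 1
    obtain e where "e \<in> moves V E"
      using assms by blast
    moreover from this have "shortener_weight V (insert e E) \<le> 3"
      using shortener_weight_insert_le[OF assms(2,3)] 1 by (metis le_trans movesE)
    ultimately show ?thesis by (auto simp: shortener_safe_def)
  next
    case 2
    obtain u v where uv: "u \<in> V" "card (component E u) = 1" "v \<in> V" "card (component E v) = 1"
      "component E u \<noteq> component E v"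
      by (rule size_count_obtain_two[OF 2(3)])
    have "shortener_safe V (insert {u, v} E)"
      using count[OF uv(1,3,5), of 4] count[OF uv(1,3,5), of 2] 2 uv by (simp add: shortener_safe_def)
    then show ?thesis
      using merge[OF uv(1,3,5)] uv by auto
  next
    case 3
    obtain u where u: "u \<in> V" "card (component E u) = 1"
      using 3 by (metis size_count_obtain less_le_trans zero_less_one)
    obtain v where v: "v \<in> V" "card (component E v) = 2"
      using 3 by (metis size_count_obtain zero_less_one)
    have ne: "component E u \<noteq> component E v"
      using u v by auto
    have "shortener_safe V (insert {u, v} E)"
      using count[OF u(1) v(1) ne, of 4] count[OF u(1) v(1) ne, of 2] 3 u v by (simp add: shortener_safe_def)
    then show ?thesis
      using merge[OF u(1) v(1) ne] u v by auto
  qed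
qed

text \<open>Outside the endgame Prolonger can spoil the invariant in two ways: by creating a
  four-vertex component, necessarily as 3 + 1, or by creating a second two-vertex component. If the
  result is still unsafe, its weight guarantees a singleton, which Shortener uses to enlarge the
  offending component.\<close>

lemma shortener_reply:
  assumes free: "p5_free E" and fin: "finite V" and E: "E \<subseteq> pairs V"
    and safe: "shortener_safe V E" and e: "e \<in> moves V E"
  shows "shortener_safe V (insert e E) \<or>
    (\<exists>e'\<in>moves V (insert e E). shortener_safe V (insert e' (insert e E)))"
proof (rule disjCI)
  assume lost: "\<not> (\<exists>e'\<in>moves V (insert e E). shortener_safe V (insert e' (insert e E)))"
  obtain u v where uv: "e = {u, v}" "u \<in> V" "v \<in> V" "u \<noteq> v" "p5_free (insert {u, v} E)"
    using e by (rule movesE)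
  let ?E = "insert {u, v} E"
  have E': "?E \<subseteq> pairs V" using E uv by simp
  note count' = size_count_merge[OF fin E'] and merge' = merge_small_move[OF uv(5) fin E']
  have "shortener_safe V ?E"
  proof (cases "shortener_weight V E \<le> 3")
    case True
    then show ?thesis
      using shortener_weight_insert_le[OF fin E uv(2,3)] by (simp add: shortener_safe_def)
  next
    case heavy: False
    then have few: "size_count V E 4 = 0" "size_count V E 2 \<le> 1"
      using safe by (auto simp: shortener_safe_def)
    show ?thesis
    proof (cases "component E u = component E v")
      case True
      then show ?thesis
        using few by (simp add: shortener_safe_def size_count_def components_insert_same)
    next
      case ne: False
      note count = size_count_merge[OF fin E uv(2,3) ne]
      let ?a = "card (component E u)" and ?b = "card (component E v)"
      have pos: "?a > 0" "?b > 0"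
        using card_component_pos[OF fin E] uv by auto
      have comp: "component ?E u = component E u \<union> component E v" "component ?E v = component E u \<union> component E v"
        by (simp_all add: component_insert)
      have card_comp: "card (component E u \<union> component E v) = ?a + ?b"
        using fin E uv ne component_subset component_cases by (metis card_Un_disjoint finite_subset)
      show ?thesis
      proof (rule ccontr)
        assume unsafe: "\<not> shortener_safe V ?E"
        show False
        proof (cases "?a + ?b = 4")
          case True
          \<comment> \<open>A merge 2 + 2 needs two components on two vertices, but there was at
            most one.\<close>
          have "?a \<noteq> 2"
            using count[of 2] few True by auto
          then have ab: "?a = 1 \<and> ?b = 3 \<or> ?a = 3 \<and> ?b = 1"
            using True pos by linarith
          then have four: "size_count V ?E 4 = 1" and two: "size_count V ?E 2 \<le> 1"
            using count[of 4] count[of 2] few by auto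
          \<comment> \<open>Without singletons the weight would be at most 2 + 1 and the position
            safe.\<close>
          then have "size_count V ?E 1 > 0"
            using unsafe by (auto simp: shortener_safe_def shortener_weight_def)
          then obtain z where z: "z \<in> V" "card (component ?E z) = 1"
            by (rule size_count_obtain)
          have z_edge: "{z, w} \<notin> ?E" for w
            by (rule singleton_component_no_edge[OF E' z(2)])
          have reply: False if xy: "{x, y} = {u, v}" "card (component E y) = 1" for x y
          proof -
            have xy': "x \<in> V" "y \<in> V" "x \<noteq> y" "component ?E x = component E u \<union> component E v"
              using xy uv comp by (auto simp: doubleton_eq_iff)
            have y_edge: "{y, w} \<notin> E" for w
              by (rule singleton_component_no_edge[OF E xy(2)])
            have ne: "component ?E x \<noteq> component ?E z"
              using z xy' card_comp True by auto
            have "z \<notin> {x, y}"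
              using z_edge[of x] z_edge[of y] xy by (auto simp: insert_commute)
            \<comment> \<open>Prolonger has just hung \<open>y\<close> at \<open>x\<close>. Hanging
              \<open>z\<close> there as its twin is legal and gives a component on five
              vertices.\<close>
            have "p5_free (insert {x, z} ?E)"
            proof (rule p5_free_insert_twin[OF uv(5), of x y z])
              show "w \<in> {x, z}" if "{y, w} \<in> ?E" for w
                using that y_edge[of w] xy xy' by (auto simp: doubleton_eq_iff)
              show "w \<in> {x, y}" if "{z, w} \<in> ?E" for w
                using that z_edge by blast
            qed (use xy xy' \<open>z \<notin> {x, y}\<close> in auto)
            then have "{x, z} \<in> moves V ?E"
              using xy' z z_edge[of x] \<open>z \<notin> {x, y}\<close> by (auto simp: moves_def insert_commute)
            moreover have "shortener_safe V (insert {x, z} ?E)"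
              using count'[OF xy'(1) z(1) ne, of 4] count'[OF xy'(1) z(1) ne, of 2] four two
                z(2) xy'(4) card_comp True by (simp add: shortener_safe_def)
            ultimately show False
              using lost uv(1) by blast
          qed
          show False
            using reply[of u v] reply[of v u] ab by (auto simp: insert_commute)
        next
          case False
          then have four: "size_count V ?E 4 = 0"
            using count[of 4] few by auto
          then have "size_count V ?E 2 = 2"
            using unsafe count[of 2] few by (auto simp: shortener_safe_def of_bool_def split: if_splits)
          \<comment> \<open>The two components on two vertices weigh only 2 together, so an unsafe
            position contains a singleton.\<close>
          moreover from this have "size_count V ?E 1 > 0"
            using unsafe four by (auto simp: shortener_safe_def shortener_weight_def)
          ultimately obtain x z where x: "x \<in> V" "card (component ?E x) = 2"
            and z: "z \<in> V" "card (component ?E z) = 1"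
            by (metis size_count_obtain zero_less_numeral)
          have ne: "component ?E x \<noteq> component ?E z"
            using x z by auto
          have "shortener_safe V (insert {x, z} ?E)"
            using count'[OF x(1) z(1) ne, of 4] count'[OF x(1) z(1) ne, of 2] four
              \<open>size_count V ?E 2 = 2\<close> x z by (simp add: shortener_safe_def)
          moreover have "{x, z} \<in> moves V ?E"
            using merge'[OF x(1) z(1) ne] x z by simp
          ultimately show False
            using lost uv(1) by blast
        qed
      qed
    qed
  qed
  then show "shortener_safe V (insert e E)"
    using uv(1) by simp
qed

lemma shortener_final:
  assumes free: "p5_free E" and fin: "finite V" and E: "E \<subseteq> pairs V" and safe: "shortener_safe V E"
  shows "card E \<le> card V + 2"
proof -
  have "size_count V E 4 \<le> 1"
    using safe unfolding shortener_safe_def shortener_weight_def by linarith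
  then show ?thesis
    using card_edges_le[OF free fin E] by (simp add: size_count_def)
qed

lemma components_empty: "components V {} = (\<lambda>x. {x}) ` V"
  by (auto simp: components_def component_def)

lemma shortener_safe_empty: "shortener_safe V {}"
proof -
  have "size_count V {} j = 0" if "j \<noteq> 1" for j
    using that by (auto simp: size_count_def components_empty card_eq_0_iff)
  then show ?thesis
    by (simp add: shortener_safe_def)
qed

subsection \<open>Prolonger's strategy\<close>

text \<open>The last condition keeps Shortener from attaching an isolated vertex to a tree on four
  vertices: whatever else Shortener merges with the only large tree of \<open>T\<close>, Prolonger can close.\<close>

definition closable :: "'a set set \<Rightarrow> 'a set set \<Rightarrow> bool" where
  "closable E T \<longleftrightarrow>
    (\<forall>C\<in>T. card C \<le> 4 \<and> (card C \<ge> 3 \<longrightarrow> (\<exists>e\<in>pairs C. e \<notin> E))) \<and>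
    (\<forall>C\<in>T. \<forall>D\<in>T. card C \<ge> 3 \<longrightarrow> card D \<ge> 3 \<longrightarrow> C = D) \<and>
    (\<forall>C\<in>T. \<forall>D\<in>T. card C = 4 \<longrightarrow> card D \<noteq> 1)"

text \<open>The set \<open>T\<close> stands for the tree components: the others may contain a tree, too, but are
  counted as if they had at least as many edges as vertices on average.\<close>

definition prolonger_safe :: "'a set \<Rightarrow> 'a set set \<Rightarrow> bool" where
  "prolonger_safe V E \<longleftrightarrow> (\<exists>T \<subseteq> components V E.
    card V \<le> card E + card T \<and> (card T \<le> 1 \<or> closable E T))"

lemma closable_subset: "closable E T \<Longrightarrow> T' \<subseteq> T \<Longrightarrow> closable E T'"
  unfolding closable_def by (meson subsetD)

lemma closable_add:
  assumes closable: "closable E T" and X: "2 \<le> card X" "card X \<le> 4"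
    and big: "card X \<ge> 3 \<Longrightarrow> \<exists>e\<in>pairs X. e \<notin> E" "\<And>C. card X \<ge> 3 \<Longrightarrow> C \<in> T \<Longrightarrow> card C \<le> 2"
    and four: "\<And>C. card X = 4 \<Longrightarrow> C \<in> T \<Longrightarrow> card C \<noteq> 1"
  shows "closable E (insert X T)"
proof -
  have "C = X" if "C \<in> T" "card X \<ge> 3" "card C \<ge> 3" for C
    using big(2)[of C] that by linarith
  \<comment> \<open>A four-vertex member of \<open>T\<close> tolerates no singleton beside it, so
    \<open>X\<close> must not be one.\<close>
  moreover have "card X \<noteq> 1" using X by simp
  moreover have "card X \<ge> 3 \<longrightarrow> (\<exists>e\<in>pairs X. e \<notin> E)" using big(1) by (rule impI)
  moreover note closable[unfolded closable_def] X(2) four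
  ultimately show ?thesis
    unfolding closable_def ball_simps(7) by (elim conjE, intro conjI ballI) (simp_all, metis+)
qed

lemma closable_insert:
  assumes "closable E T" "\<And>C. C \<in> T \<Longrightarrow> \<not> e \<subseteq> C"
  shows "closable (insert e E) T"
proof -
  have "\<exists>e'\<in>pairs C. e' \<notin> insert e E" if "C \<in> T" "\<exists>e'\<in>pairs C. e' \<notin> E" for C
    using assms(2)[OF that(1)] that(2) by (auto simp: pairs_def)
  with assms(1) show ?thesis
    unfolding closable_def by (elim conjE, intro conjI) simp_all
qed

text \<open>The new edge pays for striking \<open>C\<close> from the trees. The other members are
  disjoint from \<open>C\<close>, so their missing edges stay missing.\<close>

lemma prolonger_safe_close:
  assumes fin: "finite V" "E \<subseteq> pairs V" and T: "T \<subseteq> components V E" "card V \<le> card E + card T"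
    and C: "C \<in> T" "e \<in> pairs C" "e \<notin> E" and closable: "closable E (T - {C})"
  shows "prolonger_safe V (insert e E)"
proof -
  obtain u v where uv: "e = {u, v}" "u \<in> C" "v \<in> C"
    using C(2) by (rule pairsE)
  have "C \<in> components V E" using T C by blast
  then have "component E u = C" "component E v = C"
    using components_eq_component uv by metis+
  then have comps: "components V (insert e E) = components V E"
    unfolding uv(1) by (intro components_insert_same) simp
  have "closable (insert e E) (T - {C})"
  proof (rule closable_insert[OF closable])
    fix D assume "D \<in> T - {C}"
    then have "C \<inter> D = {}"
      using components_disjoint T C by (metis DiffE insertI1 subsetD)
    then show "\<not> e \<subseteq> D" using uv by auto
  qed
  moreover have "finite E"
    using fin finite_pairs finite_subset by blast
  then have "card V \<le> card (insert e E) + card (T - {C})"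
    using T C finite_components[OF fin(1), of E] finite_subset[of T] by (simp add: card_Diff_singleton)
  ultimately show ?thesis
    unfolding prolonger_safe_def comps using T by (intro exI[of _ "T - {C}"]) auto
qed

text \<open>Nothing but \<open>{u, v}\<close> joins the two components. So a third vertex
  \<open>p\<close> is not adjacent to whichever of \<open>u\<close>, \<open>v\<close> lies on the
  other side.\<close>

lemma components_missing_pair:
  assumes "E \<subseteq> pairs V" and ne: "component E u \<noteq> component E v"
    and big: "card (component E u \<union> component E v) \<ge> 3"
  shows "\<exists>e\<in>pairs (component E u \<union> component E v). e \<notin> insert {u, v} E"
proof -
  have disj: "component E u \<inter> component E v = {}"
    using ne component_cases by metis
  have "\<not> component E u \<union> component E v \<subseteq> {u, v}"
  proof
    assume "component E u \<union> component E v \<subseteq> {u, v}"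
    then have "card (component E u \<union> component E v) \<le> card {u, v}"
      by (intro card_mono) auto
    also have "\<dots> \<le> 2" by (simp add: card_insert_if)
    finally show False using big by simp
  qed
  then obtain p where p: "p \<in> component E u \<union> component E v" "p \<notin> {u, v}" by blast
  have "{p, v} \<notin> E" if "p \<in> component E u"
    using component_edge_mem[of p v E u] that disj component_refl[of v E] by blast
  moreover have "{p, u} \<notin> E" if "p \<in> component E v"
    using component_edge_mem[of p u E v] that disj component_refl[of u E] by blast
  ultimately obtain w where "w \<in> {u, v}" "{p, w} \<notin> E"
    using p(1) by (metis UnE insertI1 insertI2)
  then have "{p, w} \<in> pairs (component E u \<union> component E v)" "{p, w} \<notin> insert {u, v} E"
    using p by (auto simp: doubleton_eq_iff)
  then show ?thesis by (rule bexI[rotated])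
qed

text \<open>One edge is gained and at most one tree is lost, so the counting inequality survives. In
  case \<open>drop\<close> every member of \<open>T\<close> meeting the new edge is discarded; in
  case \<open>merge\<close> two members are replaced by their union.\<close>

lemma tree_components_insert:
  assumes fin: "finite V" "E \<subseteq> pairs V" and T: "T \<subseteq> components V E" "card V \<le> card E + card T"
    and uv: "u \<in> V" "v \<in> V" "{u, v} \<notin> E"
  obtains
    (drop) T' where "T' \<subseteq> components V (insert {u, v} E)" "card V \<le> card (insert {u, v} E) + card T'"
      "T' \<subseteq> T" "\<And>C. C \<in> T' \<Longrightarrow> \<not> {u, v} \<subseteq> C"
  | (merge) T' where "T' \<subseteq> components V (insert {u, v} E)" "card V \<le> card (insert {u, v} E) + card T'"
      "component E u \<noteq> component E v" "component E u \<in> T" "component E v \<in> T"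
      "T' = insert (component E u \<union> component E v) (T - {component E u, component E v})" "card T' < card T"
proof -
  let ?A = "component E u" and ?B = "component E v"
  have "finite E"
    using fin finite_pairs finite_subset by blast
  then have card_E: "card (insert {u, v} E) = Suc (card E)"
    using uv by simp
  have finT: "finite T"
    using T finite_components[OF fin(1)] finite_subset by blast
  have drop_comp: "C = ?A" if "C \<in> T" "u \<in> C" for C
    using components_eq_component T that by (metis subsetD)
  show thesis
  proof (cases "?A = ?B")
    case True
    show thesis
    proof (rule drop[of "T - {?A}"])
      show "T - {?A} \<subseteq> components V (insert {u, v} E)"
        using T components_insert_same[OF True] by auto
      have "card T \<le> Suc (card (T - {?A}))"
        using finT by (auto simp: card_Diff_singleton_if)
      then show "card V \<le> card (insert {u, v} E) + card (T - {?A})"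
        using T card_E by linarith
    qed (use drop_comp in auto)
  next
    case ne: False
    note comps = components_insert[OF uv(1,2), of E]
    show thesis
    proof (cases "?A \<in> T \<and> ?B \<in> T")
      case True
      have "?A \<union> ?B \<notin> T"
      proof
        assume "?A \<union> ?B \<in> T"
        then have "?A \<union> ?B \<in> components V E" using T by blast
        then have "?A \<union> ?B = ?A" "?A \<union> ?B = ?B"
          by (rule components_eq_component; simp)+
        with ne show False by simp
      qed
      moreover have "card (T - {?A, ?B}) = card T - 2" "card T \<ge> 2"
        using True ne finT card_mono[of T "{?A, ?B}"] by (simp_all add: card_Diff_subset)
      ultimately have card_T': "card (insert (?A \<union> ?B) (T - {?A, ?B})) = card T - 1"
        using finT by simp
      show thesis
        by (rule merge[of "insert (?A \<union> ?B) (T - {?A, ?B})"])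
          (use True ne T comps card_T' card_E \<open>card T \<ge> 2\<close> in auto)
    next
      case False
      \<comment> \<open>At most one of the two components belongs to \<open>T\<close>, so at most
        one tree is discarded.\<close>
      have "T - {?A, ?B} = T - {?A} \<or> T - {?A, ?B} = T - {?B}"
        using False by blast
      moreover have "card T \<le> Suc (card (T - {C}))" for C
        using finT by (auto simp: card_Diff_singleton_if)
      ultimately have "card T \<le> Suc (card (T - {?A, ?B}))"
        by metis
      then show thesis
        by (intro drop[of "T - {?A, ?B}"]) (use T comps card_E drop_comp in auto)
    qed
  qed
qed

lemma component_fill_small:
  assumes "p5_free E" "finite V" "E \<subseteq> pairs V" "C \<in> components V E" "card C \<le> 4" "e \<in> pairs C" "e \<notin> E"
  shows "e \<in> moves V E"
proof -
  obtain u v where uv: "e = {u, v}" "u \<in> C" "v \<in> C" "u \<noteq> v"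
    using assms(6) by (rule pairsE)
  have "C \<subseteq> V"
    using components_subset assms by blast
  moreover have "component E u \<union> component E v = C"
    using components_eq_component[OF assms(4)] uv by blast
  ultimately show ?thesis
    using p5_free_insert_small[of E u v] assms uv finite_subset[of C V] by (auto simp: moves_def)
qed

text \<open>With at most one tree any move is harmless, and the bound already holds if there is
  none. Otherwise a move always exists: an edge missing in a tree on at least three vertices, or a
  merge of two trees on at most two vertices. The second disjunct provides the lower bound at the
  end of the game.\<close>

lemma prolonger_move:
  assumes free: "p5_free E" and fin: "finite V" and E: "E \<subseteq> pairs V"
    and safe: "prolonger_safe V E"
  shows "(\<exists>e\<in>moves V E. prolonger_safe V (insert e E)) \<or> moves V E = {} \<and> card V - 1 \<le> card E"
proof (rule disjCI)
  assume "\<not> (moves V E = {} \<and> card V - 1 \<le> card E)"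
  obtain T where T: "T \<subseteq> components V E" "card V \<le> card E + card T" "card T \<le> 1 \<or> closable E T"
    using safe by (auto simp: prolonger_safe_def)
  have finT: "finite T"
    using T finite_components[OF fin] finite_subset by blast
  consider "card T \<le> 1" | C where "closable E T" "C \<in> T" "card C \<ge> 3"
    | "closable E T" "card T \<ge> 2" "\<And>C. C \<in> T \<Longrightarrow> card C \<le> 2"
  proof (cases "card T \<le> 1 \<or> (\<exists>C\<in>T. card C \<ge> 3)")
    case True
    then show thesis using that(1,2) T(3) by metis
  next
    case False
    have "card C \<le> 2" if "C \<in> T" for C
    proof -
      have "\<not> card C \<ge> 3" using False that by blast
      then show ?thesis by linarith
    qed
    with False show thesis using that(3) T(3) by simp
  qed
  then show "\<exists>e\<in>moves V E. prolonger_safe V (insert e E)"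
  proof cases
    case 1
    then have "card V - 1 \<le> card E" using T(2) by linarith
    then obtain e where e: "e \<in> moves V E"
      using \<open>\<not> (moves V E = {} \<and> card V - 1 \<le> card E)\<close> by blast
    then obtain u v where uv: "e = {u, v}" "u \<in> V" "v \<in> V" "{u, v} \<notin> E"
      by (metis movesE)
    have "prolonger_safe V (insert {u, v} E)"
    proof (cases rule: tree_components_insert[OF fin E T(1,2) uv(2-4)])
      case (1 T')
      then have "card T' \<le> 1"
        using \<open>card T \<le> 1\<close> card_mono[OF finT] by (meson le_trans)
      then show ?thesis using 1 unfolding prolonger_safe_def by blast
    next
      case (2 T')
      then have "card T' \<le> 1"
        using \<open>card T \<le> 1\<close> by linarith
      then show ?thesis using 2 unfolding prolonger_safe_def by blast
    qed
    then show ?thesis using e uv by blast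
  next
    case 2
    then obtain e where e: "e \<in> pairs C" "e \<notin> E" "card C \<le> 4"
      unfolding closable_def by blast
    have "e \<in> moves V E"
      using component_fill_small[OF free fin E _ e(3,1,2)] T 2 by blast
    moreover have "prolonger_safe V (insert e E)"
      using prolonger_safe_close[OF fin E T(1,2) 2(2) e(1,2)] closable_subset[OF 2(1)] by blast
    ultimately show ?thesis by blast
  next
    case 3
    obtain A' where "A' \<in> T" using 3 by fastforce
    then have "\<exists>A. A \<in> T \<and> (\<forall>D. D \<in> T \<longrightarrow> card A \<le> card D)"
      by (rule ex_has_least_nat)
    then obtain A where A: "A \<in> T" "\<And>D. D \<in> T \<Longrightarrow> card A \<le> card D"
      by blast
    have "T \<noteq> {A}"
    proof
      assume "T = {A}"
      with 3(2) show False by simp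
    qed
    \<comment> \<open>\<open>A\<close> is a smallest member and \<open>B\<close> any other one. If
      their union has four vertices, then \<open>A\<close> has two, so no singleton is left in
      \<open>T\<close>, as \<open>closable\<close> demands.\<close>
    then obtain B where B: "B \<in> T" "B \<noteq> A" using A by blast
    obtain u v where uv: "u \<in> V" "A = component E u" "v \<in> V" "B = component E v"
      using A(1) B(1) T(1) unfolding components_def by (metis imageE subsetD)
    have ne: "component E u \<noteq> component E v" using B uv by simp
    have move: "{u, v} \<in> moves V E"
      by (rule merge_small_move[OF free fin E uv(1,3) ne]) (use 3(3)[OF A(1)] 3(3)[OF B(1)] uv in simp)
    then have new: "{u, v} \<notin> E" by (simp add: moves_def)
    have "prolonger_safe V (insert {u, v} E)"
    proof (cases rule: tree_components_insert[OF fin E T(1,2) uv(1,3) new])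
      case (1 T')
      then show ?thesis
        using closable_insert[OF closable_subset[OF 3(1)]] unfolding prolonger_safe_def by blast
    next
      case (2 T')
      have "closable (insert {u, v} E) (insert (A \<union> B) (T - {A, B}))"
      proof (rule closable_add)
        have "closable E (T - {A, B})"
          by (rule closable_subset[OF 3(1)]) blast
        then show "closable (insert {u, v} E) (T - {A, B})"
        proof (rule closable_insert)
          fix C assume C: "C \<in> T - {A, B}"
          show "\<not> {u, v} \<subseteq> C"
          proof
            assume "{u, v} \<subseteq> C"
            then have "C = A"
              using C T components_eq_component[of C V E u] uv by blast
            then show False using C by blast
          qed
        qed
        have "A \<inter> B = {}"
          using ne component_cases uv by metis
        moreover have "finite A" "finite B"
          using component_subset[OF E] uv fin finite_subset by metis+
        ultimately have card_Un: "card (A \<union> B) = card A + card B"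
          by (simp add: card_Un_disjoint)
        have AB: "0 < card A" "card A \<le> card B" "card B \<le> 2"
          using card_component_pos[OF fin E uv(1)] uv A B 3(3) by auto
        show "2 \<le> card (A \<union> B)" "card (A \<union> B) \<le> 4"
          using card_Un AB by linarith+
        show "\<exists>e\<in>pairs (A \<union> B). e \<notin> insert {u, v} E" if "card (A \<union> B) \<ge> 3"
          using components_missing_pair[OF E ne] that uv by simp
        fix C assume C: "C \<in> T - {A, B}"
        show "card C \<le> 2"
          using C 3(3) by blast
        have "card A \<le> card C"
          using C A by blast
        then show "card C \<noteq> 1" if "card (A \<union> B) = 4"
          using that card_Un AB by linarith
      qed
      then have "closable (insert {u, v} E) T'"
        using 2(6) uv by simp
      then show ?thesis
        using 2 unfolding prolonger_safe_def by blast
    qed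
    then show ?thesis using move by blast
  qed
qed

text \<open>The component of \<open>v\<close> is a single edge \<open>{v, w}\<close>, and
  \<open>{u, w}\<close> completes a triangle. Here \<open>v\<close> and \<open>w\<close> are twins
  at \<open>u\<close>, so this is legal however large the component of \<open>u\<close> is.\<close>

lemma close_pendant_edge:
  assumes free: "p5_free (insert {u, v} E)" and fin: "finite V" and E: "E \<subseteq> pairs V"
    and u: "u \<in> V" "v \<in> V" and ne: "component E u \<noteq> component E v" and B: "card (component E v) = 2"
  shows "\<exists>e\<in>moves V (insert {u, v} E). e \<in> pairs (component E u \<union> component E v)"
proof -
  obtain w where w: "component E v = {v, w}" "w \<noteq> v"
  proof -
    obtain x y where xy: "component E v = {x, y}" "x \<noteq> y"
      using B by (auto simp: card_2_iff)
    then have "v = x \<or> v = y"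
      using component_refl[of v E] by simp
    then show thesis
      using xy that[of x] that[of y] by (auto simp: insert_commute)
  qed
  have disj: "component E u \<inter> component E v = {}"
    using ne component_cases by metis
  then have uw: "u \<notin> {v, w}"
    using component_refl[of u E] w by auto
  have nbr: "z \<in> {v, w} \<and> z \<noteq> y" if "{y, z} \<in> E" "y \<in> {v, w}" for y z
  proof
    show "z \<in> {v, w}"
      using component_edge_mem[of y z E v] that w by simp
    show "z \<noteq> y"
      using that E pairs_iff by (metis subsetD)
  qed
  have new: "{u, w} \<notin> insert {u, v} E"
    using nbr[of w u] uw w by (auto simp: doubleton_eq_iff insert_commute)
  have "p5_free (insert {u, w} (insert {u, v} E))"
  proof (rule p5_free_insert_twin[OF free])
    show "z \<in> {u, w}" if "{v, z} \<in> insert {u, v} E" for z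
      using that nbr[of v z] uw by (auto simp: doubleton_eq_iff)
    show "z \<in> {u, v}" if "{w, z} \<in> insert {u, v} E" for z
      using that nbr[of w z] uw w by (auto simp: doubleton_eq_iff)
  qed (use uw w in auto)
  moreover have "w \<in> V"
    using component_subset[OF E u(2)] w by auto
  ultimately have "{u, w} \<in> moves V (insert {u, v} E)"
    using u uw new by (auto simp: moves_def)
  moreover have "{u, w} \<in> pairs (component E u \<union> component E v)"
    using uw w by auto
  ultimately show ?thesis by blast
qed

text \<open>Only a merge of two trees into at least three vertices needs an answer. Prolonger closes
  a cycle in the union and strikes it from \<open>T\<close>; what remains of \<open>T\<close> is
  closable as before.\<close>

lemma prolonger_reply:
  assumes free: "p5_free E" and fin: "finite V" and E: "E \<subseteq> pairs V"
    and safe: "prolonger_safe V E" and e: "e \<in> moves V E"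
  shows "prolonger_safe V (insert e E) \<or>
    (\<exists>e'\<in>moves V (insert e E). prolonger_safe V (insert e' (insert e E)))"
proof -
  obtain T where T: "T \<subseteq> components V E" "card V \<le> card E + card T" "card T \<le> 1 \<or> closable E T"
    using safe by (auto simp: prolonger_safe_def)
  have finT: "finite T"
    using T finite_components[OF fin] finite_subset by blast
  obtain u v where uv: "e = {u, v}" "u \<in> V" "v \<in> V" "u \<noteq> v" "{u, v} \<notin> E" "p5_free (insert {u, v} E)"
    using e by (rule movesE)
  let ?E = "insert {u, v} E"
  have E': "?E \<subseteq> pairs V" using E uv by simp
  have "prolonger_safe V ?E \<or> (\<exists>e'\<in>moves V ?E. prolonger_safe V (insert e' ?E))"
  proof (cases rule: tree_components_insert[OF fin E T(1,2) uv(2,3,5)])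
    case (1 T')
    then have "card T' \<le> 1 \<or> closable ?E T'"
      using T(3) closable_subset closable_insert card_mono[OF finT 1(3)] by (metis le_trans)
    then show ?thesis
      using 1 unfolding prolonger_safe_def by blast
  next
    case (2 T')
    let ?A = "component E u" and ?B = "component E v"
    show ?thesis
    proof (cases "card T \<le> 1")
      case True
      then show ?thesis
        using 2 unfolding prolonger_safe_def by (metis le_trans less_imp_le)
    next
      case False
      then have cl: "closable E T" using T by blast
      have disj: "?A \<inter> ?B = {}"
        using 2(3) component_cases by metis
      have "finite ?A" "finite ?B"
        using component_subset[OF E] uv fin finite_subset by metis+
      then have card_Un: "card (?A \<union> ?B) = card ?A + card ?B"
        using disj by (rule card_Un_disjoint)
      have pos: "card ?A > 0" "card ?B > 0"
        using card_component_pos[OF fin E] uv by auto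
      have outside: "\<not> {u, v} \<subseteq> C" if "C \<in> T - {?A, ?B}" for C
      proof
        assume "{u, v} \<subseteq> C"
        then have "C = ?A"
          using that T components_eq_component[of C V E u] by blast
        then show False using that by blast
      qed
      have rest: "closable ?E (T - {?A, ?B})"
      proof (rule closable_insert[OF closable_subset[OF cl]])
        show "T - {?A, ?B} \<subseteq> T" by (rule Diff_subset)
      qed (fact outside)
      show ?thesis
      proof (cases "card (?A \<union> ?B) \<ge> 3")
        case False
        then have one: "card ?A = 1" "card ?B = 1"
          using card_Un pos by auto
        have "closable ?E T'"
          unfolding 2(6) by (rule closable_add[OF rest]) (use card_Un one in simp_all)
        then show ?thesis
          using 2 unfolding prolonger_safe_def by blast
      next
        case True
        have AB: "card ?A \<le> 4" "card ?B \<le> 4" "\<not> (card ?A \<ge> 3 \<and> card ?B \<ge> 3)"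
          "card ?A = 4 \<Longrightarrow> card ?B \<noteq> 1" "card ?B = 4 \<Longrightarrow> card ?A \<noteq> 1"
          using cl 2(3-5) unfolding closable_def by blast+
        have "?A \<union> ?B \<in> components V ?E"
          using 2 by blast
        obtain e' where e': "e' \<in> moves V ?E" "e' \<in> pairs (?A \<union> ?B)"
        proof -
          \<comment> \<open>Both parts have at most four vertices, at most one has three or more,
            and 4 + 1 is excluded by \<open>closable\<close>. So a union on more than four vertices
            is 3 + 2 or 4 + 2 and has a two-vertex part.\<close>
          consider "card (?A \<union> ?B) \<le> 4" | "card ?A = 2" | "card ?B = 2"
            using AB card_Un pos by linarith
          then show thesis
          proof cases
            case 1
            then show thesis
              using components_missing_pair[OF E 2(3) True] that
                component_fill_small[OF uv(6) fin E' \<open>?A \<union> ?B \<in> components V ?E\<close>] by blast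
          next
            case 2
            then show thesis
              using close_pendant_edge[of v u E V] uv fin E \<open>?A \<noteq> ?B\<close> that
              by (metis Un_commute insert_commute)
          next
            case 3
            then show thesis
              using close_pendant_edge[OF uv(6) fin E uv(2,3) \<open>?A \<noteq> ?B\<close>] that by blast
          qed
        qed
        have "closable ?E (T' - {?A \<union> ?B})"
          by (rule closable_subset[OF rest]) (use 2(6) in auto)
        then have "prolonger_safe V (insert e' ?E)"
          using prolonger_safe_close[OF fin E' 2(1,2) _ e'(2)] 2(6) e' by (simp add: moves_def)
        then show ?thesis
          using e' by blast
      qed
    qed
  qed
  then show ?thesis
    using uv(1) by simp
qed

lemma prolonger_safe_empty:
  assumes "finite V"
  shows "prolonger_safe V {}"
proof -
  have "card (components V {}) = card V"
    unfolding components_empty by (intro card_image) simp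
  moreover have "closable {} (components V {})"
    by (auto simp: closable_def components_empty)
  ultimately show ?thesis
    unfolding prolonger_safe_def by (intro exI[of _ "components V {}"]) simp
qed

theorem theorem3:
  fixes n :: nat and first_player :: player
  assumes "n > 0"
  shows "n - 1 \<le> game_sat first_player (complete_graph n) {path_graph 5}
       \<and> game_sat first_player (complete_graph n) {path_graph 5} \<le> n + 2"
proof
  let ?V = "{..<n}"
  show "n - 1 \<le> game_sat first_player (complete_graph n) {path_graph 5}"
  proof (rule game_sat_complete_graph_invariant[where s = Prolonger and J = "prolonger_safe ?V" and Q = "\<lambda>m. n - 1 \<le> m"])
    show "n - 1 \<le> opt Prolonger A" if "finite A" "a \<in> A" "n - 1 \<le> a" for A a
      using that by (auto intro: order_trans)
    show "n - 1 \<le> card E"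
      if "E \<subseteq> pairs ?V" "p5_free E" "prolonger_safe ?V E" "moves ?V E = {}" for E
      using prolonger_move[of E ?V] that by simp
    show "\<exists>e\<in>moves ?V E. prolonger_safe ?V (insert e E)"
      if "E \<subseteq> pairs ?V" "p5_free E" "prolonger_safe ?V E" "moves ?V E \<noteq> {}" for E
      using prolonger_move[of E ?V] that by simp
  qed (simp_all add: prolonger_reply prolonger_safe_empty)
  show "game_sat first_player (complete_graph n) {path_graph 5} \<le> n + 2"
  proof (rule game_sat_complete_graph_invariant[where s = Shortener and J = "shortener_safe ?V" and Q = "\<lambda>m. m \<le> n + 2"])
    show "opt Shortener A \<le> n + 2" if "finite A" "a \<in> A" "a \<le> n + 2" for A a
      using order_trans[OF Min_le[OF that(1,2)] that(3)] by simp
    show "card E \<le> n + 2"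
      if "E \<subseteq> pairs ?V" "p5_free E" "shortener_safe ?V E" "moves ?V E = {}" for E
      using shortener_final[of E ?V] that by simp
  qed (simp_all add: shortener_move shortener_reply shortener_safe_empty)
qed

end
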